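(* Let $p\ge 2$ and suppose $z(t)\in L^p(\Omega,\mathbb P)$ for every $t\in[0,T]$ and $\int_0^T \mathbb E[|z(t)|^p]^{2/p}\,dt<+\infty$. Let $F:[0,T]\times\mathbb R\to\mathbb R$ satisfy: (i) $F(t,\xi)\ge 0$ for all $(t,\xi)$; (ii) $F(t,\xi)$ is twice continuously differentiable in $\xi$ and $\frac{\partial F}{\partial \xi}$, $\frac{\partial^2 F}{\partial \xi^2}$ are continuous functions of both variables; (iii) there exist $\alpha\in(0,p)$ and a non-negative $L\in L^1(0,T)$ such that $|F(t,\xi)|+\left|\frac{\partial F}{\partial \xi}(t,\xi)\right|+\left|\frac{\partial^2 F}{\partial \xi^2}(t,\xi)\right|\le L(t)(1+|\xi|^\alpha)$ for all $t\in[0,T]$, $\xi\in\mathbb R$; (iv) for every fixed $t\in[0,T]$ the function $\xi\mapsto F(t,\xi)$ is convex. Let $\delta>0$ and let $\Psi\in\Delta_2$ be a Young function. Then there exists $\overline u_{\delta,\Psi}\in L^1(0,T)$ such that $$\min_{u\in L^1(0,T)}J_{\delta,\Psi}[u]=J_{\delta,\Psi}[\overline u_{\delta,\Psi}].$$ Moreover, if $\xi\mapsto F(t,\xi)$ is strictly convex for every fixed $t\in[0,T]$, or if $\Psi$ is strictly convex, then $\overline u_{\delta,\Psi}\in L^1(0,T)$ is unique.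
   Context: Fix $T>0$, a filtered probability space $(\Omega,\mathcal F,(\mathcal F_t)_{t\ge 0},\mathbb P)$ and an $\mathcal F_t$-Brownian motion $W$ (started at $0$). $a:[0,T]\to\mathbb R$ is a deterministic function in $L^\infty(0,T)$, $A(t)=\int_0^t a(s)\,ds$, $G(t)=e^{W(t)-t/2}$. $z$ is a real $\mathcal F_t$-adapted, jointly measurable process; $F$ is Borel measurable. $L^1(0,T)$ denotes deterministic integrable real functions (identified when equal a.e.). For $u\in L^1(0,T)$ put $$\xi_u(t)=G(t)e^{A(t)}\int_0^t\frac{e^{-A(s)}}{G(s)}(z(s)-u(s))\,ds,\qquad J[u]=\mathbb E\left[\int_0^T F(t,\xi_u(t))\,dt\right].$$ A Young function is a function $\Psi:[0,+\infty)\to[0,+\infty)$ of the form $\Psi(t)=\int_0^t\psi(s)\,ds$ with $\psi:[0,+\infty)\to[0,+\infty)$, $\psi(0)=0$, $\psi(s)>0$ for $s>0$, $\psi$ right-continuous, non-decreasing, and $\lim_{s\to+\infty}\psi(s)=+\infty$. $\Psi\in\Delta_2$ means there is $k>0$ with $\Psi(2t)\le k\Psi(t)$ for all $t\ge0$. For $u\in L^1(0,T)$ and $\delta>0$, $\mathcal F_\Psi[u]=\int_0^T\Psi(|u(t)|)\,dt\in[0,+\infty]$ and $J_{\delta,\Psi}[u]=J[u]+\delta\,\mathcal F_\Psi[u]$. *)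

theory Defs
  imports "HOL-Probability.Probability"
begin

locale filtered_prob_space = prob_space M
  for M :: "'a measure" and Filt :: "real \<Rightarrow> 'a measure" +
  assumes subalgebra_Filt: "0 \<le> t \<Longrightarrow> subalgebra M (Filt t)"
    and Filt_mono: "0 \<le> s \<Longrightarrow> s \<le> t \<Longrightarrow> sets (Filt s) \<subseteq> sets (Filt t)"

text \<open>
  Standard Brownian motion relative to a filtration. The start at 0 and the continuity of the
  paths are only required almost surely, and no completeness or right-continuity of the filtration
  is assumed.
\<close>

definition brownian_motion ::
  "'a measure \<Rightarrow> (real \<Rightarrow> 'a measure) \<Rightarrow> (real \<Rightarrow> 'a \<Rightarrow> real) \<Rightarrow> bool" where
  "brownian_motion M Filt W \<longleftrightarrow>
     (\<forall>t\<ge>0. W t \<in> borel_measurable (Filt t)) \<and>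
     (AE \<omega> in M. W 0 \<omega> = 0) \<and>
     (AE \<omega> in M. continuous_on {0..} (\<lambda>t. W t \<omega>)) \<and>
     (\<forall>s t. 0 \<le> s \<and> s < t \<longrightarrow>
        distributed M lborel (\<lambda>\<omega>. W t \<omega> - W s \<omega>) (normal_density 0 (sqrt (t - s))) \<and>
        prob_space.indep_set M (sets (Filt s))
          {(\<lambda>\<omega>. W t \<omega> - W s \<omega>) -` B \<inter> space M | B. B \<in> sets borel})"

text \<open>
  Elements of \<open>L\<^sup>1(0,T)\<close> and \<open>L\<^sup>\<infinity>(0,T)\<close> are represented by functions on the reals of which only
  the restriction to \<open>[0,T]\<close> matters. Every Lebesgue class has a Borel representative, so \<open>lborel\<close>
  suffices; the identification of functions equal almost everywhere is made explicit where
  equality is asserted.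
\<close>

definition L1 :: "real \<Rightarrow> (real \<Rightarrow> real) set" where
  "L1 T = {u. set_integrable lborel {0..T} u}"

definition Linf :: "real \<Rightarrow> (real \<Rightarrow> real) set" where
  "Linf T = {a. set_borel_measurable lborel {0..T} a \<and>
                (\<exists>C. AE t in lborel. t \<in> {0..T} \<longrightarrow> \<bar>a t\<bar> \<le> C)}"

definition primitive :: "(real \<Rightarrow> real) \<Rightarrow> real \<Rightarrow> real" where
  "primitive a t = (LINT s:{0..t}|lborel. a s)"

definition geom_bm :: "(real \<Rightarrow> 'a \<Rightarrow> real) \<Rightarrow> real \<Rightarrow> 'a \<Rightarrow> real" where
  "geom_bm W t \<omega> = exp (W t \<omega> - t / 2)"

text \<open>The state \<open>\<xi>\<^sub>u(t)\<close>; the time integral is taken path by path.\<close>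

definition state ::
  "(real \<Rightarrow> 'a \<Rightarrow> real) \<Rightarrow> (real \<Rightarrow> real) \<Rightarrow> (real \<Rightarrow> 'a \<Rightarrow> real) \<Rightarrow> (real \<Rightarrow> real)
     \<Rightarrow> real \<Rightarrow> 'a \<Rightarrow> real" where
  "state W a z u t \<omega> =
     geom_bm W t \<omega> * exp (primitive a t) *
     (LINT s:{0..t}|lborel. exp (- primitive a s) / geom_bm W s \<omega> * (z s \<omega> - u s))"

text \<open>
  The functionals take values in \<open>[0,\<infinity>]\<close>. The expectation and the time integral in \<open>cost\<close> are
  integrals of nonnegative functions, so \<open>cost\<close> is only meaningful for running costs \<open>F \<ge> 0\<close>
  (negative values would be truncated by \<open>ennreal\<close>).
\<close>

definition cost ::
  "'a measure \<Rightarrow> real \<Rightarrow> (real \<Rightarrow> 'a \<Rightarrow> real) \<Rightarrow> (real \<Rightarrow> real) \<Rightarrow> (real \<Rightarrow> 'a \<Rightarrow> real)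
     \<Rightarrow> (real \<Rightarrow> real \<Rightarrow> real) \<Rightarrow> (real \<Rightarrow> real) \<Rightarrow> ennreal" where
  "cost M T W a z F u =
     (\<integral>\<^sup>+\<omega>. (\<integral>\<^sup>+t\<in>{0..T}. ennreal (F t (state W a z u t \<omega>)) \<partial>lborel) \<partial>M)"

definition young_function :: "(real \<Rightarrow> real) \<Rightarrow> bool" where
  "young_function \<Psi> \<longleftrightarrow>
     (\<exists>\<psi>. \<psi> 0 = 0 \<and> (\<forall>s>0. \<psi> s > 0) \<and>
          (\<forall>s\<ge>0. continuous (at_right s) \<psi>) \<and> mono_on {0..} \<psi> \<and>
          filterlim \<psi> at_top at_top \<and>
          (\<forall>t\<ge>0. \<Psi> t = (LINT s:{0..t}|lborel. \<psi> s)))"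

definition Delta2 :: "(real \<Rightarrow> real) \<Rightarrow> bool" where
  "Delta2 \<Psi> \<longleftrightarrow> (\<exists>k>0. \<forall>t\<ge>0. \<Psi> (2 * t) \<le> k * \<Psi> t)"

definition young_integral :: "real \<Rightarrow> (real \<Rightarrow> real) \<Rightarrow> (real \<Rightarrow> real) \<Rightarrow> ennreal" where
  "young_integral T \<Psi> u = (\<integral>\<^sup>+t\<in>{0..T}. ennreal (\<Psi> \<bar>u t\<bar>) \<partial>lborel)"

definition penalized_cost ::
  "'a measure \<Rightarrow> real \<Rightarrow> (real \<Rightarrow> 'a \<Rightarrow> real) \<Rightarrow> (real \<Rightarrow> real) \<Rightarrow> (real \<Rightarrow> 'a \<Rightarrow> real)
     \<Rightarrow> (real \<Rightarrow> real \<Rightarrow> real) \<Rightarrow> real \<Rightarrow> (real \<Rightarrow> real) \<Rightarrow> (real \<Rightarrow> real) \<Rightarrow> ennreal" where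
  "penalized_cost M T W a z F \<delta> \<Psi> u =
     cost M T W a z F u + ennreal \<delta> * young_integral T \<Psi> u"

definition strictly_convex_on :: "'a::real_vector set \<Rightarrow> ('a \<Rightarrow> real) \<Rightarrow> bool" where
  "strictly_convex_on S f \<longleftrightarrow> convex S \<and>
     (\<forall>x\<in>S. \<forall>y\<in>S. \<forall>r. x \<noteq> y \<and> 0 < r \<and> r < 1 \<longrightarrow>
        f ((1 - r) *\<^sub>R x + r *\<^sub>R y) < (1 - r) * f x + r * f y)"

end

theory Submission
  imports Defs
begin

text \<open>
  The penalised functional is convex, lower semicontinuous and, because the Young function grows
  faster than linearly, its sublevel sets are uniformly integrable. The usual way to a minimiser
  (weak compactness by Dunford and Pettis, then Mazur's lemma) is replaced by an elementary selection
  in \<open>exists_L1_minimizer\<close>. In the sublevel set of level \<open>inf J + 1/n\<close> choose a near-minimiser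
  of the auxiliary functional \<open>u \<mapsto> \<integral> sqrt (1 + u\<^sup>2)\<close>. Midpoints of later choices stay in the
  same sublevel set, so the convexity gap of the auxiliary functional between two late choices is
  small. The auxiliary integrand is uniformly convex on bounded sets and the penalty controls the
  large values (\<open>abs_diff_le_soft_abs_gap\<close>), hence the choices form a Cauchy sequence in norm. Its
  limit lies in every sublevel set, since these are closed.

  Convexity and closedness of the sublevel sets come from the structure of the state: path by path it
  is an affine function of the control, given by a Volterra integral with a bounded kernel, so
  norm convergence of controls gives convergence of the state at each time (\<open>\<xi>_midpoint\<close>,
  \<open>\<xi>_tendsto\<close>), and Fatou's lemma applies to the running cost and to the penalty. The paths of \<open>W\<close>
  are continuous and those of \<open>z\<close> integrable only almost surely; both processes are therefore changed
  on a null set, which makes the state jointly measurable and leaves the cost unchanged.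

  The minimal value is finite because the zero control has finite cost. With
  \<open>\<beta> = max \<alpha> 1 < p\<close>, Jensen's inequality, weighted by the \<open>p\<close>-th moments of \<open>z\<close>, moves the power
  \<open>\<beta>\<close> inside the Volterra integral, and Young's inequality splits the product of \<open>z\<close> with the ratio
  \<open>G(t) / G(s)\<close> into a \<open>p\<close>-th moment of \<open>z\<close> and some higher moment of the ratio, which is a Gaussian
  exponential moment (\<open>\<xi>_zero_moment_bound\<close>).

  For uniqueness, the midpoint of two minimisers is again a minimiser, so the convexity
  inequalities of both terms are equalities. If the Young function is strictly convex, the controls
  agree. If the running cost is strictly convex, the states agree almost everywhere; one path
  then suffices to recover the control, because an integrable function whose primitive vanishes is
  zero almost everywhere (\<open>AE_eq_of_\<xi>_eq\<close>).
\<close>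

section \<open>Convexity and semicontinuity of integral functionals\<close>

lemma strictly_convex_on_midpoint:
  fixes f :: "real \<Rightarrow> real"
  assumes "strictly_convex_on S f" "x \<in> S" "y \<in> S" "x \<noteq> y"
  shows "f ((x + y) / 2) < (f x + f y) / 2"
proof -
  have "f ((1 - 1/2) *\<^sub>R x + (1/2) *\<^sub>R y) < (1 - 1/2) * f x + (1/2) * f y"
    using assms(1)[unfolded strictly_convex_on_def, THEN conjunct2, rule_format, of x y "1/2"] assms(2-4) by simp
  moreover have "(1 - 1/2) *\<^sub>R x + (1/2) *\<^sub>R y = (x + y) / 2" by (simp add: field_simps)
  ultimately show ?thesis by (simp add: field_simps)
qed

lemma liminf_add_le_ennreal:
  fixes f g :: "nat \<Rightarrow> ennreal"
  shows "liminf f + liminf g \<le> liminf (\<lambda>n. f n + g n)"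
proof -
  have inc: "incseq (\<lambda>n. INF k\<in>{n..}. h k)" for h :: "nat \<Rightarrow> ennreal"
    by (intro incseq_SucI INF_superset_mono) auto
  have "liminf f + liminf g = (SUP n. (INF k\<in>{n..}. f k) + (INF k\<in>{n..}. g k))"
    unfolding liminf_SUP_INF by (rule ennreal_SUP_add[OF inc inc, symmetric])
  also have "\<dots> \<le> (SUP n. INF k\<in>{n..}. f k + g k)"
    by (intro SUP_mono' INF_greatest add_mono INF_lower) auto
  finally show ?thesis by (simp add: liminf_SUP_INF)
qed

lemma ennreal_le_max_of_double_le_add:
  fixes a b c :: ennreal
  assumes "2 * a \<le> b + c" shows "a \<le> max b c"
proof (rule ccontr)
  assume "\<not> a \<le> max b c"
  then have lt: "b < a" "c < a" by (auto simp: not_le)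
  have "b + c < a + a"
    using lt by (cases a; cases b; cases c) (auto simp flip: ennreal_plus simp: ennreal_less_iff)
  then show False using assms by (simp add: mult_2 leD)
qed

text \<open>Two convexity inequalities whose sum is an equality are equalities one by one.\<close>

lemma ennreal_sum_squeeze:
  fixes a b c d :: ennreal
  assumes "a \<le> b" "c \<le> d" "b + d \<le> a + c" "b < \<infinity>" "d < \<infinity>"
  shows "b \<le> a" "d \<le> c"
  using assms by (cases a; cases b; cases c; cases d; auto simp flip: ennreal_plus simp: ennreal_le_iff top_unique)+

lemma nn_integral_midpoint:
  fixes f g h :: "'q \<Rightarrow> real"
  assumes [measurable]: "f \<in> borel_measurable N" "g \<in> borel_measurable N"
    and nonneg: "\<And>q. q \<in> space N \<Longrightarrow> f q \<ge> 0" "\<And>q. q \<in> space N \<Longrightarrow> g q \<ge> 0"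
    and mid: "\<And>q. q \<in> space N \<Longrightarrow> h q \<le> (f q + g q) / 2"
  shows "2 * (\<integral>\<^sup>+q. ennreal (h q) \<partial>N) \<le> (\<integral>\<^sup>+q. ennreal (f q) \<partial>N) + (\<integral>\<^sup>+q. ennreal (g q) \<partial>N)"
proof -
  have half: "2 * ennreal ((f q + g q) / 2) = ennreal (f q) + ennreal (g q)" if "q \<in> space N" for q
  proof -
    have "2 * ennreal ((f q + g q) / 2) = ennreal 2 * ennreal ((f q + g q) / 2)" by simp
    also have "\<dots> = ennreal (2 * ((f q + g q) / 2))"
      using nonneg[OF that] by (intro ennreal_mult[symmetric]) auto
    also have "2 * ((f q + g q) / 2) = f q + g q" by (simp add: field_simps)
    finally show ?thesis using nonneg[OF that] by simp
  qed
  have "2 * (\<integral>\<^sup>+q. ennreal (h q) \<partial>N) \<le> 2 * (\<integral>\<^sup>+q. ennreal ((f q + g q) / 2) \<partial>N)"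
    using mid by (intro mult_left_mono nn_integral_mono ennreal_leI) auto
  also have "\<dots> = (\<integral>\<^sup>+q. 2 * ennreal ((f q + g q) / 2) \<partial>N)"
    by (intro nn_integral_cmult[symmetric]) measurable
  also have "\<dots> = (\<integral>\<^sup>+q. ennreal (f q) + ennreal (g q) \<partial>N)"
    using half by (intro nn_integral_cong) auto
  also have "\<dots> = (\<integral>\<^sup>+q. ennreal (f q) \<partial>N) + (\<integral>\<^sup>+q. ennreal (g q) \<partial>N)"
    by (intro nn_integral_add) measurable
  finally show ?thesis .
qed

text \<open>Equality of the integrals, which are finite, turns the pointwise midpoint inequality into an almost
  everywhere equality; this is how strict convexity of an integrand is exploited below.\<close>

lemma nn_integral_midpoint_strict:
  fixes f g h :: "'q \<Rightarrow> real"
  assumes [measurable]: "f \<in> borel_measurable N" "g \<in> borel_measurable N" "h \<in> borel_measurable N"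
    and nonneg: "\<And>q. q \<in> space N \<Longrightarrow> f q \<ge> 0" "\<And>q. q \<in> space N \<Longrightarrow> g q \<ge> 0"
      "\<And>q. q \<in> space N \<Longrightarrow> h q \<ge> 0"
    and mid: "\<And>q. q \<in> space N \<Longrightarrow> h q \<le> (f q + g q) / 2"
    and fin: "(\<integral>\<^sup>+q. ennreal (f q) \<partial>N) < \<infinity>" "(\<integral>\<^sup>+q. ennreal (g q) \<partial>N) < \<infinity>"
    and eq: "(\<integral>\<^sup>+q. ennreal (f q) \<partial>N) + (\<integral>\<^sup>+q. ennreal (g q) \<partial>N) \<le> 2 * (\<integral>\<^sup>+q. ennreal (h q) \<partial>N)"
  shows "AE q in N. (f q + g q) / 2 \<le> h q"
proof (rule ccontr)
  let ?k = "\<lambda>q. (f q + g q) / 2"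
  assume neg: "\<not> (AE q in N. ?k q \<le> h q)"
  have add: "2 * (\<integral>\<^sup>+q. ennreal (?k q) \<partial>N) \<le> (\<integral>\<^sup>+q. ennreal (f q) \<partial>N) + (\<integral>\<^sup>+q. ennreal (g q) \<partial>N)"
    using nonneg by (intro nn_integral_midpoint) auto
  have "(\<integral>\<^sup>+q. ennreal (h q) \<partial>N) \<le> (\<integral>\<^sup>+q. ennreal (?k q) \<partial>N)"
    using mid by (intro nn_integral_mono ennreal_leI) auto
  have finsum: "(\<integral>\<^sup>+q. ennreal (f q) \<partial>N) + (\<integral>\<^sup>+q. ennreal (g q) \<partial>N) < \<infinity>"
    using fin by simp
  have kfin: "2 * (\<integral>\<^sup>+q. ennreal (?k q) \<partial>N) < \<infinity>"
    using add finsum by (rule le_less_trans)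
  have hfin: "(\<integral>\<^sup>+q. ennreal (h q) \<partial>N) \<noteq> \<infinity>"
    using \<open>(\<integral>\<^sup>+q. ennreal (h q) \<partial>N) \<le> (\<integral>\<^sup>+q. ennreal (?k q) \<partial>N)\<close> kfin
    by (auto simp: top_unique ennreal_mult_eq_top_iff)
  have "(\<integral>\<^sup>+q. ennreal (h q) \<partial>N) < (\<integral>\<^sup>+q. ennreal (?k q) \<partial>N)"
  proof (rule nn_integral_less)
    show "\<not> (AE q in N. ennreal (?k q) \<le> ennreal (h q))"
    proof
      assume "AE q in N. ennreal (?k q) \<le> ennreal (h q)"
      then have "AE q in N. ?k q \<le> h q"
      proof (rule AE_mp, intro AE_I2 impI)
        fix q assume q: "q \<in> space N" and *: "ennreal (?k q) \<le> ennreal (h q)"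
        then show "?k q \<le> h q" using nonneg(3)[OF q] by (simp add: ennreal_le_iff)
      qed
      with neg show False by blast
    qed
  qed (use mid hfin in \<open>auto intro!: ennreal_leI\<close>)
  then have "2 * (\<integral>\<^sup>+q. ennreal (h q) \<partial>N) < 2 * (\<integral>\<^sup>+q. ennreal (?k q) \<partial>N)"
    by (intro ennreal_mult_strict_left_mono) auto
  with add eq show False by (auto dest: leD order.strict_trans2)
qed

text \<open>Fatou's lemma in the form used for lower semicontinuity of both integral functionals.\<close>

lemma nn_integral_le_of_AE_tendsto:
  fixes f :: "nat \<Rightarrow> 'q \<Rightarrow> real"
  assumes [measurable]: "\<And>n. f n \<in> borel_measurable N"
    and lim: "AE q in N. (\<lambda>n. f n q) \<longlonglongrightarrow> g q"
  shows "(\<integral>\<^sup>+q. ennreal (g q) \<partial>N) \<le> liminf (\<lambda>n. \<integral>\<^sup>+q. ennreal (f n q) \<partial>N)"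
proof -
  have "(\<integral>\<^sup>+q. ennreal (g q) \<partial>N) = (\<integral>\<^sup>+q. liminf (\<lambda>n. ennreal (f n q)) \<partial>N)"
  proof (rule nn_integral_cong_AE)
    show "AE q in N. ennreal (g q) = liminf (\<lambda>n. ennreal (f n q))"
      using lim
    proof eventually_elim
      case (elim q)
      from lim_imp_Liminf[OF _ tendsto_ennrealI[OF this]] show ?case by simp
    qed
  qed
  also have "\<dots> \<le> liminf (\<lambda>n. \<integral>\<^sup>+q. ennreal (f n q) \<partial>N)"
    by (rule nn_integral_liminf) measurable
  finally show ?thesis .
qed

section \<open>Minimisation of coercive functionals of integrable functions\<close>

text \<open>Completeness of \<open>L\<^sup>1\<close>, with the almost everywhere convergent subsequence kept: Fatou's lemma along
  this subsequence transfers the Cauchy estimate to the limit.\<close>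

lemma L1_complete:
  fixes s :: "nat \<Rightarrow> 'a \<Rightarrow> real"
  assumes int: "\<And>n. integrable N (s n)"
    and cauchy: "\<And>e. e > 0 \<Longrightarrow> \<exists>k. \<forall>i\<ge>k. \<forall>j\<ge>k. (\<integral>x. \<bar>s i x - s j x\<bar> \<partial>N) < e"
  obtains r u where "strict_mono (r :: nat \<Rightarrow> nat)" "integrable N u"
    "AE x in N. (\<lambda>i. s (r i) x) \<longlonglongrightarrow> u x" "(\<lambda>n. \<integral>x. \<bar>s n x - u x\<bar> \<partial>N) \<longlonglongrightarrow> 0"
proof -
  obtain r where r: "strict_mono r" "AE x in N. Cauchy (\<lambda>i. s (r i) x)"
    using cauchy_L1_AE_cauchy_subseq[of N s] int cauchy by (auto simp: real_norm_def)
  define u where "u x = lim (\<lambda>i. s (r i) x)" for x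
  have [measurable]: "s n \<in> borel_measurable N" for n using int by auto
  have u_meas [measurable]: "u \<in> borel_measurable N"
    unfolding u_def by measurable
  have lim: "AE x in N. (\<lambda>i. s (r i) x) \<longlonglongrightarrow> u x"
    using r(2) by eventually_elim (auto simp: u_def Cauchy_convergent_iff convergent_LIMSEQ_iff)
  have bound: "\<exists>k. \<forall>n\<ge>k. (\<integral>\<^sup>+x. ennreal \<bar>s n x - u x\<bar> \<partial>N) \<le> ennreal e" if e: "e > 0" for e
  proof -
    obtain k where k: "\<forall>i\<ge>k. \<forall>j\<ge>k. (\<integral>x. \<bar>s i x - s j x\<bar> \<partial>N) < e" using cauchy[OF e] by blast
    have "(\<integral>\<^sup>+x. ennreal \<bar>s n x - u x\<bar> \<partial>N) \<le> ennreal e" if n: "n \<ge> k" for n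
    proof -
      have "(\<integral>\<^sup>+x. ennreal \<bar>s n x - u x\<bar> \<partial>N)
          = (\<integral>\<^sup>+x. liminf (\<lambda>i. ennreal \<bar>s n x - s (r i) x\<bar>) \<partial>N)"
      proof (rule nn_integral_cong_AE)
        show "AE x in N. ennreal \<bar>s n x - u x\<bar> = liminf (\<lambda>i. ennreal \<bar>s n x - s (r i) x\<bar>)"
          using lim
        proof eventually_elim
          case (elim x)
          then have "(\<lambda>i. ennreal \<bar>s n x - s (r i) x\<bar>) \<longlonglongrightarrow> ennreal \<bar>s n x - u x\<bar>"
            by (intro tendsto_ennrealI tendsto_intros)
          from lim_imp_Liminf[OF _ this] show ?case by simp
        qed
      qed
      also have "\<dots> \<le> liminf (\<lambda>i. \<integral>\<^sup>+x. ennreal \<bar>s n x - s (r i) x\<bar> \<partial>N)"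
        by (rule nn_integral_liminf) measurable
      also have "\<dots> \<le> ennreal e"
      proof (rule Liminf_le)
        have "(\<integral>\<^sup>+x. ennreal \<bar>s n x - s (r i) x\<bar> \<partial>N) \<le> ennreal e" if "i \<ge> k" for i
        proof -
          have "r i \<ge> k" using that seq_suble[OF r(1), of i] by simp
          then have "(\<integral>x. \<bar>s n x - s (r i) x\<bar> \<partial>N) \<le> e" using k n by (simp add: less_imp_le)
          then show ?thesis using int
            by (subst nn_integral_eq_integral) (auto intro!: ennreal_leI)
        qed
        then show "\<forall>\<^sub>F i in sequentially. (\<integral>\<^sup>+x. ennreal \<bar>s n x - s (r i) x\<bar> \<partial>N) \<le> ennreal e"
          by (rule eventually_sequentiallyI)
      qed simp
      finally show ?thesis .
    qed
    then show ?thesis by blast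
  qed
  obtain k where "(\<integral>\<^sup>+x. ennreal \<bar>s k x - u x\<bar> \<partial>N) \<le> ennreal 1"
    using bound[of 1] by auto
  then have "integrable N (\<lambda>x. s k x - u x)"
    by (intro integrableI_bounded) (auto intro: le_less_trans)
  from Bochner_Integration.integrable_diff[OF int[of k] this] have u_int: "integrable N u" by simp
  have "(\<lambda>n. \<integral>x. \<bar>s n x - u x\<bar> \<partial>N) \<longlonglongrightarrow> 0"
  proof (rule LIMSEQ_I)
    fix e :: real assume "e > 0"
    then obtain k where k: "\<forall>n\<ge>k. (\<integral>\<^sup>+x. ennreal \<bar>s n x - u x\<bar> \<partial>N) \<le> ennreal (e/2)"
      using bound[of "e/2"] by auto
    have "norm ((\<integral>x. \<bar>s n x - u x\<bar> \<partial>N) - 0) < e" if "n \<ge> k" for n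
    proof -
      have "ennreal (\<integral>x. \<bar>s n x - u x\<bar> \<partial>N) \<le> ennreal (e/2)"
        using k that int u_int by (subst nn_integral_eq_integral[symmetric]) auto
      then show ?thesis using \<open>e > 0\<close> by (auto simp: ennreal_le_iff)
    qed
    then show "\<exists>no. \<forall>n\<ge>no. norm ((\<integral>x. \<bar>s n x - u x\<bar> \<partial>N) - 0) < e" by blast
  qed
  with r(1) u_int lim show thesis by (rule that)
qed

text \<open>A smooth substitute for the absolute value: it has linear growth, so that it is integrable along
  every integrable function, and it is strictly convex.\<close>

definition soft_abs :: "real \<Rightarrow> real" where "soft_abs x = sqrt (1 + x\<^sup>2)"

definition soft_abs_gap :: "real \<Rightarrow> real \<Rightarrow> real" where
  "soft_abs_gap x y = (soft_abs x + soft_abs y) / 2 - soft_abs ((x + y) / 2)"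

text \<open>Squaring twice reduces the claim to the Cauchy-Schwarz inequality for the vectors \<open>(1, x)\<close> and
  \<open>(1, y)\<close>, which is strict because distinct vectors of this form are linearly independent.\<close>

lemma soft_abs_gap_pos:
  assumes "x \<noteq> y" shows "soft_abs_gap x y > 0"
proof -
  have "(1 + x * y)\<^sup>2 < (1 + x\<^sup>2) * (1 + y\<^sup>2)"
  proof -
    have "(1 + x\<^sup>2) * (1 + y\<^sup>2) - (1 + x * y)\<^sup>2 = (x - y)\<^sup>2" by algebra
    moreover have "(x - y)\<^sup>2 > 0" using assms by simp
    ultimately show ?thesis by linarith
  qed
  then have "1 + x * y < soft_abs x * soft_abs y"
    unfolding soft_abs_def real_sqrt_mult[symmetric] by (rule real_less_rsqrt)
  then have "1 + ((x + y) / 2)\<^sup>2 < ((soft_abs x + soft_abs y) / 2)\<^sup>2"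
    by (simp add: power2_eq_square field_simps soft_abs_def)
  then have "soft_abs ((x + y) / 2) < (soft_abs x + soft_abs y) / 2"
    unfolding soft_abs_def by (intro real_less_lsqrt) (auto simp: add_nonneg_nonneg)
  then show ?thesis by (simp add: soft_abs_gap_def)
qed

lemma soft_abs_gap_nonneg: "soft_abs_gap x y \<ge> 0"
proof (cases "x = y")
  case False then show ?thesis using soft_abs_gap_pos[of x y] by simp
qed (simp add: soft_abs_gap_def)

lemma continuous_soft_abs_gap: "continuous_on UNIV (\<lambda>p. soft_abs_gap (fst p) (snd p))"
  unfolding soft_abs_gap_def soft_abs_def by (intro continuous_intros) auto

text \<open>If one of the arguments is large, superlinearity of \<open>\<Theta>\<close> alone bounds the difference. On a bounded
  square, away from the diagonal, the gap has a positive minimum by compactness. Integrated, the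
  estimate says that functions with bounded \<open>\<Theta>\<close>-integral and small gap are close in norm; it takes the
  place of uniform integrability.\<close>

lemma abs_diff_le_soft_abs_gap:
  fixes \<Theta> :: "real \<Rightarrow> real"
  assumes nonneg: "\<And>t. \<Theta> t \<ge> 0"
    and superlinear: "\<And>K. \<exists>R. \<forall>t. \<bar>t\<bar> \<ge> R \<longrightarrow> K * \<bar>t\<bar> \<le> \<Theta> t"
    and "\<epsilon> > 0"
  shows "\<exists>c\<ge>0. \<forall>x y. \<bar>x - y\<bar> \<le> \<epsilon> * (1 + \<Theta> x + \<Theta> y) + c * soft_abs_gap x y"
proof -
  obtain R where R: "\<And>t. \<bar>t\<bar> \<ge> R \<Longrightarrow> 2 / \<epsilon> * \<bar>t\<bar> \<le> \<Theta> t"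
    using superlinear[of "2/\<epsilon>"] by blast
  have R': "2 * \<bar>t\<bar> \<le> \<epsilon> * \<Theta> t" if "\<bar>t\<bar> \<ge> R" for t
    using R[OF that] \<open>\<epsilon> > 0\<close> by (simp add: field_simps)
  define S where "S = {p \<in> {-R..R} \<times> {-R..R}. \<epsilon> \<le> \<bar>fst p - snd p\<bar>}"
  have S: "compact S"
  proof -
    have "closed {p :: real \<times> real. \<epsilon> \<le> \<bar>fst p - snd p\<bar>}"
      by (intro closed_Collect_le continuous_intros)
    moreover have "S = ({-R..R} \<times> {-R..R}) \<inter> {p. \<epsilon> \<le> \<bar>fst p - snd p\<bar>}"
      by (auto simp: S_def)
    ultimately show ?thesis by (auto intro!: compact_Int_closed compact_Times)
  qed
  obtain m where m: "m > 0" "\<And>p. p \<in> S \<Longrightarrow> m \<le> soft_abs_gap (fst p) (snd p)"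
  proof (cases "S = {}")
    case False
    obtain q where q: "q \<in> S" "\<forall>p\<in>S. soft_abs_gap (fst q) (snd q) \<le> soft_abs_gap (fst p) (snd p)"
      using continuous_attains_inf[OF S False] continuous_on_subset[OF continuous_soft_abs_gap] by blast
    have "fst q \<noteq> snd q" using q(1) \<open>\<epsilon> > 0\<close> by (auto simp: S_def)
    then show thesis using q soft_abs_gap_pos that by blast
  qed (use that[of 1] in auto)
  define c where "c = 2 * \<bar>R\<bar> / m"
  have "\<bar>x - y\<bar> \<le> \<epsilon> * (1 + \<Theta> x + \<Theta> y) + c * soft_abs_gap x y" for x y
  proof -
    have c0: "c \<ge> 0" using m(1) by (simp add: c_def)
    have g0: "c * soft_abs_gap x y \<ge> 0" using c0 soft_abs_gap_nonneg by simp
    have t0: "\<epsilon> * \<Theta> x \<ge> 0" "\<epsilon> * \<Theta> y \<ge> 0" using nonneg \<open>\<epsilon> > 0\<close> by auto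
    have e: "\<epsilon> * (1 + \<Theta> x + \<Theta> y) = \<epsilon> + \<epsilon> * \<Theta> x + \<epsilon> * \<Theta> y" by algebra
    consider "\<bar>x\<bar> \<ge> R \<or> \<bar>y\<bar> \<ge> R" | "\<bar>x - y\<bar> < \<epsilon>" | "\<bar>x\<bar> < R" "\<bar>y\<bar> < R" "\<epsilon> \<le> \<bar>x - y\<bar>" by linarith
    then show ?thesis
    proof cases
      case 1
      then have "2 * max \<bar>x\<bar> \<bar>y\<bar> \<le> \<epsilon> * \<Theta> x + \<epsilon> * \<Theta> y"
      proof (cases "\<bar>x\<bar> \<le> \<bar>y\<bar>")
        case True
        then show ?thesis using R'[of y] 1 t0 by auto
      next
        case False
        then show ?thesis using R'[of x] 1 t0 by auto
      qed
      then show ?thesis using g0 e \<open>\<epsilon> > 0\<close> by linarith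
    next
      case 2 then show ?thesis using g0 e t0 by linarith
    next
      case 3
      then have "(x, y) \<in> S" by (auto simp: S_def)
      then have "m \<le> soft_abs_gap x y" using m(2) by fastforce
      then have "c * m \<le> c * soft_abs_gap x y" using c0 by (rule mult_left_mono)
      moreover have "c * m = 2 * \<bar>R\<bar>" using m(1) by (simp add: c_def)
      ultimately show ?thesis using 3 e t0 \<open>\<epsilon> > 0\<close> by linarith
    qed
  qed
  moreover have "c \<ge> 0" using m(1) by (simp add: c_def)
  ultimately show ?thesis by blast
qed

lemma soft_abs_le: "soft_abs x \<le> 1 + \<bar>x\<bar>"
  unfolding soft_abs_def by (rule real_le_lsqrt) (auto simp: power2_eq_square algebra_simps)

lemma soft_abs_nonneg: "soft_abs x \<ge> 0"
  by (simp add: soft_abs_def add_nonneg_nonneg)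

lemma borel_measurable_soft_abs [measurable]: "soft_abs \<in> borel_measurable borel"
  unfolding soft_abs_def by measurable

lemma (in finite_measure) integrable_soft_abs:
  assumes "integrable M u" shows "integrable M (\<lambda>x. soft_abs (u x))"
proof (rule Bochner_Integration.integrable_bound)
  show "integrable M (\<lambda>x. 1 + \<bar>u x\<bar>)" using assms by auto
  show "AE x in M. norm (soft_abs (u x)) \<le> norm (1 + \<bar>u x\<bar>)"
    using soft_abs_le soft_abs_nonneg by (auto intro!: AE_I2)
qed (use assms in measurable)

text \<open>The sublevel sets \<open>C n\<close> at height \<open>m + 1 / (n + 1)\<close> decrease, are stable under midpoints and closed,
  and the claim is that they have a common point. Let \<open>c n\<close> be the infimum of \<open>\<Phi>\<close>, the integral of
  \<open>soft_abs\<close>, on \<open>C n\<close>. These numbers increase and are bounded by coercivity. If \<open>s n\<close> nearly attains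
  \<open>c n\<close>, the midpoint of two late terms lies in \<open>C n\<close>, where \<open>\<Phi>\<close> is at least \<open>c n\<close>, while the
  values at the two terms are hardly larger than the limit of \<open>c\<close>. So their convexity gap tends to zero
  and the sequence \<open>s\<close> is Cauchy.\<close>

theorem (in finite_measure) exists_L1_minimizer:
  fixes J :: "('a \<Rightarrow> real) \<Rightarrow> ennreal" and \<Theta> :: "real \<Rightarrow> real"
  assumes quasiconvex: "\<And>u v. integrable M u \<Longrightarrow> integrable M v \<Longrightarrow>
        J (\<lambda>x. (u x + v x) / 2) \<le> max (J u) (J v)"
    and lsc: "\<And>s u c. (\<And>n. integrable M (s n)) \<Longrightarrow> integrable M u \<Longrightarrow>
        (AE x in M. (\<lambda>n. s n x) \<longlonglongrightarrow> u x) \<Longrightarrow> (\<lambda>n. \<integral>x. \<bar>s n x - u x\<bar> \<partial>M) \<longlonglongrightarrow> 0 \<Longrightarrow>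
        (\<And>n. J (s n) \<le> c) \<Longrightarrow> J u \<le> c"
    and \<Theta>_meas [measurable]: "\<Theta> \<in> borel_measurable borel" and \<Theta>_nonneg: "\<And>t. \<Theta> t \<ge> 0"
    and superlinear: "\<And>K. \<exists>R. \<forall>t. \<bar>t\<bar> \<ge> R \<longrightarrow> K * \<bar>t\<bar> \<le> \<Theta> t"
    and "\<delta> > 0" and coercive: "\<And>u. integrable M u \<Longrightarrow> ennreal \<delta> * (\<integral>\<^sup>+x. ennreal (\<Theta> (u x)) \<partial>M) \<le> J u"
    and u0: "integrable M u0" "J u0 < \<infinity>"
  shows "\<exists>u. integrable M u \<and> J u < \<infinity> \<and> (\<forall>v. integrable M v \<longrightarrow> J u \<le> J v)"
proof -
  define m where "m = (INF u\<in>{u. integrable M u}. J u)"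
  have m_le: "m \<le> J v" if "integrable M v" for v
    unfolding m_def using that by (intro INF_lower) auto
  have m_fin: "m < top" using m_le[OF u0(1)] u0(2) by (simp add: le_less_trans)
  define C where "C n = {u. integrable M u \<and> J u \<le> m + ennreal (1 / real (Suc n))}" for n
  have C_ne: "C n \<noteq> {}" for n
  proof -
    have "m < m + ennreal (1 / real (Suc n))" using m_fin by (cases m) (auto simp flip: ennreal_plus simp: ennreal_less_iff)
    then obtain u where "integrable M u" "J u < m + ennreal (1 / real (Suc n))"
      unfolding m_def by (subst (asm) INF_less_iff) auto
    then show ?thesis by (auto simp: C_def less_imp_le)
  qed
  have C_anti: "C k \<subseteq> C n" if "n \<le> k" for n k
  proof -
    have "ennreal (1 / real (Suc k)) \<le> ennreal (1 / real (Suc n))"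
      using that by (intro ennreal_leI) (auto simp: field_simps)
    then show ?thesis by (auto simp: C_def intro: order_trans add_left_mono)
  qed
  have C_mid: "(\<lambda>x. (u x + v x) / 2) \<in> C n" if "u \<in> C n" "v \<in> C n" for u v n
    using that quasiconvex[of u v] by (auto simp: C_def max_def split: if_splits intro: order_trans)

  \<comment> \<open>The height of \<open>C 0\<close> is \<open>m + 1\<close>, hence this bound for the \<open>\<Theta>\<close>-integrals on \<open>C 0\<close>.\<close>
  define B where "B = enn2real (m + 1) / \<delta>"
  have \<Theta>_int: "integrable M (\<lambda>x. \<Theta> (u x))" and \<Theta>_le: "(\<integral>x. \<Theta> (u x) \<partial>M) \<le> B" if "u \<in> C 0" for u
  proof -
    have [measurable]: "u \<in> borel_measurable M" using that by (auto simp: C_def)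
    have *: "ennreal \<delta> * (\<integral>\<^sup>+x. ennreal (\<Theta> (u x)) \<partial>M) \<le> m + 1"
      using coercive[of u] that by (auto simp: C_def intro: order_trans)
    also have m1: "m + 1 < top" using m_fin by simp
    finally have "(\<integral>\<^sup>+x. ennreal (\<Theta> (u x)) \<partial>M) < top" using \<open>\<delta> > 0\<close>
      by (auto simp: ennreal_mult_less_top)
    then show int: "integrable M (\<lambda>x. \<Theta> (u x))"
      using \<Theta>_nonneg by (intro integrableI_bounded) auto
    have "ennreal (\<delta> * (\<integral>x. \<Theta> (u x) \<partial>M)) \<le> m + 1"
      using * \<Theta>_nonneg int \<open>\<delta> > 0\<close> by (simp add: nn_integral_eq_integral ennreal_mult integral_nonneg_AE)
    then have "ennreal (\<delta> * (\<integral>x. \<Theta> (u x) \<partial>M)) \<le> ennreal (enn2real (m + 1))"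
      using m1 by simp
    then have "\<delta> * (\<integral>x. \<Theta> (u x) \<partial>M) \<le> enn2real (m + 1)"
      by (simp add: ennreal_le_iff)
    then show "(\<integral>x. \<Theta> (u x) \<partial>M) \<le> B" using \<open>\<delta> > 0\<close> by (simp add: B_def field_simps)
  qed
  define \<Phi> where "\<Phi> u = (\<integral>x. soft_abs (u x) \<partial>M)" for u
  have \<Phi>_nonneg: "\<Phi> u \<ge> 0" for u
    unfolding \<Phi>_def using soft_abs_nonneg by (intro integral_nonneg_AE) auto
  obtain R where R: "\<forall>t. \<bar>t\<bar> \<ge> R \<longrightarrow> 1 * \<bar>t\<bar> \<le> \<Theta> t" using superlinear by blast
  define B' where "B' = (1 + \<bar>R\<bar>) * measure M (space M) + B"
  have \<Phi>_le: "\<Phi> u \<le> B'" if u: "u \<in> C 0" for u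
  proof -
    have "soft_abs t \<le> 1 + \<bar>R\<bar> + \<Theta> t" for t
    proof (cases "\<bar>t\<bar> \<ge> R")
      case True then show ?thesis using R soft_abs_le[of t] by fastforce
    next
      case False then show ?thesis using soft_abs_le[of t] \<Theta>_nonneg[of t] by linarith
    qed
    then have "\<Phi> u \<le> (\<integral>x. (1 + \<bar>R\<bar>) + \<Theta> (u x) \<partial>M)"
      unfolding \<Phi>_def using u \<Theta>_int[OF u] integrable_soft_abs[of u]
      by (intro integral_mono) (auto simp: C_def)
    also have "\<dots> = (1 + \<bar>R\<bar>) * measure M (space M) + (\<integral>x. \<Theta> (u x) \<partial>M)"
      using \<Theta>_int[OF u] by (subst Bochner_Integration.integral_add) auto
    finally show ?thesis using \<Theta>_le[OF u] by (simp add: B'_def)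
  qed

  define c where "c n = Inf (\<Phi> ` C n)" for n
  have bdd: "bdd_below (\<Phi> ` C n)" for n
    using \<Phi>_nonneg by (intro bdd_belowI[of _ 0]) auto
  have c_le: "c n \<le> \<Phi> u" if "u \<in> C n" for u n
    unfolding c_def using that bdd by (intro cInf_lower) auto
  have c_mono: "c n \<le> c k" if "n \<le> k" for n k
    unfolding c_def using C_ne C_anti[OF that] bdd by (intro cInf_superset_mono) auto
  have c_bound: "c n \<le> B'" for n
  proof -
    obtain u where "u \<in> C n" using C_ne by blast
    then show ?thesis using c_le \<Phi>_le C_anti[of 0 n] by (meson le0 order_trans subsetD)
  qed
  obtain cinf where cinf: "c \<longlonglongrightarrow> cinf" "\<forall>n. c n \<le> cinf"
    using incseq_convergent[of c B'] c_mono c_bound by (auto simp: incseq_def)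
  have "\<exists>u. u \<in> C n \<and> \<Phi> u < c n + 1 / real (Suc n)" for n
  proof -
    have "c n < c n + 1 / real (Suc n)" by simp
    then obtain y where "y \<in> \<Phi> ` C n" "y < c n + 1 / real (Suc n)"
      unfolding c_def using C_ne by (subst (asm) cInf_less_iff[OF _ bdd]) auto
    then show ?thesis by blast
  qed
  then obtain s where s: "\<And>n. s n \<in> C n" "\<And>n. \<Phi> (s n) < c n + 1 / real (Suc n)" by metis
  have s_int: "integrable M (s n)" for n using s(1) by (auto simp: C_def)
  have s_C: "s i \<in> C n" if "n \<le> i" for i n using s(1) C_anti[OF that] by blast

  define gap where "gap n = cinf - c n + 1 / real (Suc n)" for n
  have gap_int: "integrable M (\<lambda>x. soft_abs_gap (s i x) (s j x))" for i j
    unfolding soft_abs_gap_def using integrable_soft_abs[OF s_int] integrable_soft_abs[of "\<lambda>x. (s i x + s j x) / 2"] s_int by auto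
  have gap_le: "(\<integral>x. soft_abs_gap (s i x) (s j x) \<partial>M) \<le> gap n" if "n \<le> i" "n \<le> j" for i j n
  proof -
    have "(\<integral>x. soft_abs_gap (s i x) (s j x) \<partial>M) = (\<Phi> (s i) + \<Phi> (s j)) / 2 - \<Phi> (\<lambda>x. (s i x + s j x) / 2)"
      unfolding soft_abs_gap_def \<Phi>_def
      using integrable_soft_abs[OF s_int] integrable_soft_abs[of "\<lambda>x. (s i x + s j x) / 2"] s_int by auto
    then have "2 * (\<integral>x. soft_abs_gap (s i x) (s j x) \<partial>M) = \<Phi> (s i) + \<Phi> (s j) - 2 * \<Phi> (\<lambda>x. (s i x + s j x) / 2)"
      by (simp add: field_simps)
    moreover have "c n \<le> \<Phi> (\<lambda>x. (s i x + s j x) / 2)" by (intro c_le C_mid s_C that)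
    moreover have near: "\<Phi> (s k) \<le> cinf + 1 / real (Suc n)" if "n \<le> k" for k
    proof -
      have "1 / real (Suc k) \<le> 1 / real (Suc n)" using that by (auto simp: field_simps)
      then show ?thesis using s(2)[of k] cinf(2)[rule_format, of k] by linarith
    qed
    ultimately show ?thesis using near[OF that(1)] near[OF that(2)] unfolding gap_def by linarith
  qed
  have gap_lim: "gap \<longlonglongrightarrow> 0"
  proof -
    have "gap \<longlonglongrightarrow> cinf - cinf + 0"
      unfolding gap_def by (intro tendsto_intros cinf LIMSEQ_Suc[OF lim_const_over_n])
    then show ?thesis by simp
  qed

  have cauchy: "\<exists>k. \<forall>i\<ge>k. \<forall>j\<ge>k. (\<integral>x. \<bar>s i x - s j x\<bar> \<partial>M) < e" if "e > 0" for e
  proof -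
    \<comment> \<open>\<open>V\<close> bounds the integral of \<open>1 + \<Theta> (s i) + \<Theta> (s j)\<close>; each of the two terms of the estimate gets \<open>e / 2\<close>.\<close>
    define V where "V = measure M (space M) + 2 * \<bar>B\<bar> + 1"
    have V: "V > 0" by (simp add: V_def add_nonneg_pos)
    define \<epsilon> where "\<epsilon> = e / (2 * V)"
    have \<epsilon>: "\<epsilon> > 0" using V that by (simp add: \<epsilon>_def)
    obtain d where d: "d \<ge> 0" "\<forall>x y. \<bar>x - y\<bar> \<le> \<epsilon> * (1 + \<Theta> x + \<Theta> y) + d * soft_abs_gap x y"
      using abs_diff_le_soft_abs_gap[OF \<Theta>_nonneg superlinear \<epsilon>] by blast
    have "(\<lambda>n. d * gap n) \<longlonglongrightarrow> d * 0" by (intro tendsto_intros gap_lim)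
    then have "\<forall>\<^sub>F n in sequentially. d * gap n < e / 2" using that by (intro order_tendstoD(2)) auto
    then obtain k where k: "d * gap k < e / 2" by (auto simp: eventually_sequentially)
    have "(\<integral>x. \<bar>s i x - s j x\<bar> \<partial>M) < e" if ij: "i \<ge> k" "j \<ge> k" for i j
    proof -
      note \<Theta>i = \<Theta>_int[OF s_C[of 0]]
      have "(\<integral>x. \<bar>s i x - s j x\<bar> \<partial>M)
          \<le> (\<integral>x. \<epsilon> * (1 + \<Theta> (s i x) + \<Theta> (s j x)) + d * soft_abs_gap (s i x) (s j x) \<partial>M)"
        using d(2) s_int \<Theta>i gap_int by (intro integral_mono) auto
      also have "\<dots> = \<epsilon> * (measure M (space M) + (\<integral>x. \<Theta> (s i x) \<partial>M) + (\<integral>x. \<Theta> (s j x) \<partial>M))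
          + d * (\<integral>x. soft_abs_gap (s i x) (s j x) \<partial>M)"
        using \<Theta>i gap_int by simp
      also have "\<dots> \<le> \<epsilon> * V + d * gap k"
        using \<Theta>_le[OF s_C[of 0 i]] \<Theta>_le[OF s_C[of 0 j]] \<epsilon> d(1) gap_le[OF ij]
        by (intro add_mono mult_left_mono) (auto simp: V_def)
      also have "\<dots> < e" using k V by (simp add: \<epsilon>_def)
      finally show ?thesis .
    qed
    then show ?thesis by blast
  qed
  obtain r u where r: "strict_mono (r :: nat \<Rightarrow> nat)" and u: "integrable M u"
    and lim: "AE x in M. (\<lambda>i. s (r i) x) \<longlonglongrightarrow> u x" and L1: "(\<lambda>n. \<integral>x. \<bar>s n x - u x\<bar> \<partial>M) \<longlonglongrightarrow> 0"
    using L1_complete[OF s_int cauchy] by blast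
  have J_le: "J u \<le> m + ennreal (1 / real (Suc n))" for n
  proof (rule lsc[of "\<lambda>i. s (r (i + n))"])
    show "AE x in M. (\<lambda>i. s (r (i + n)) x) \<longlonglongrightarrow> u x"
      using lim by eventually_elim (rule LIMSEQ_ignore_initial_segment)
    show "(\<lambda>i. \<integral>x. \<bar>s (r (i + n)) x - u x\<bar> \<partial>M) \<longlonglongrightarrow> 0"
      using LIMSEQ_ignore_initial_segment[OF LIMSEQ_subseq_LIMSEQ[OF L1 r], of n] by (simp add: o_def)
    show "J (s (r (i + n))) \<le> m + ennreal (1 / real (Suc n))" for i
      using s_C[of n "r (i + n)"] seq_suble[OF r, of "i + n"] by (auto simp: C_def)
  qed (use s_int u in auto)
  have "J u \<le> m"
  proof (rule LIMSEQ_le_const)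
    have "(\<lambda>n. m + ennreal (1 / real (Suc n))) \<longlonglongrightarrow> m + ennreal 0"
      by (intro tendsto_intros tendsto_ennrealI LIMSEQ_Suc[OF lim_const_over_n])
    then show "(\<lambda>n. m + ennreal (1 / real (Suc n))) \<longlonglongrightarrow> m" by simp
  qed (use J_le in blast)
  then show ?thesis using u m_le m_fin by (auto intro!: exI[of _ u] intro: order_trans le_less_trans)
qed

section \<open>Young functions\<close>

text \<open>The slopes of \<open>\<Psi>\<close> on an interval lie between the values of its density at the end points. Convexity,
  continuity and superlinear growth of \<open>\<Psi>\<close> are read off from these bounds.\<close>

lemma young_function_increment:
  assumes "young_function \<Psi>"
  obtains \<psi> where "\<psi> 0 = 0" "\<And>s. s > 0 \<Longrightarrow> \<psi> s > 0" "mono_on {0..} \<psi>" "filterlim \<psi> at_top at_top"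
    "\<And>x y. 0 \<le> x \<Longrightarrow> x \<le> y \<Longrightarrow> \<psi> x * (y - x) \<le> \<Psi> y - \<Psi> x"
    "\<And>x y. 0 \<le> x \<Longrightarrow> x \<le> y \<Longrightarrow> \<Psi> y - \<Psi> x \<le> \<psi> y * (y - x)"
proof -
  obtain \<psi> where \<psi>: "\<psi> 0 = 0" "\<And>s. s > 0 \<Longrightarrow> \<psi> s > 0" "mono_on {0..} \<psi>" "filterlim \<psi> at_top at_top"
    and \<Psi>: "\<And>t. t \<ge> 0 \<Longrightarrow> \<Psi> t = (LINT s:{0..t}|lborel. \<psi> s)"
    using assms unfolding young_function_def by blast
  have mono: "\<psi> s \<le> \<psi> t" if "0 \<le> s" "s \<le> t" for s t
    using mono_onD[OF \<psi>(3)] that by auto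
  have meas: "set_borel_measurable lborel {x..y} \<psi>" if "0 \<le> x" for x y
  proof -
    have "mono_on {x..y} \<psi>" by (rule mono_on_subset[OF \<psi>(3)]) (use that in auto)
    from borel_measurable_mono_on_fnc[OF this]
    show ?thesis
      by (simp add: set_borel_measurable_def borel_measurable_restrict_space_iff mult.commute)
  qed
  have int: "set_integrable lborel {x..y} \<psi>" if "0 \<le> x" for x y
    unfolding set_integrable_def
  proof (rule Bochner_Integration.integrable_bound)
    show "integrable lborel (\<lambda>s. indicator {x..y} s *\<^sub>R \<psi> y)"
      by (intro integrable_scaleR_left integrable_real_indicator) (auto simp: emeasure_lborel_Icc_eq)
    show "AE s in lborel. norm (indicat_real {x..y} s *\<^sub>R \<psi> s) \<le> norm (indicat_real {x..y} s *\<^sub>R \<psi> y)"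
    proof (intro AE_I2)
      fix s show "norm (indicat_real {x..y} s *\<^sub>R \<psi> s) \<le> norm (indicat_real {x..y} s *\<^sub>R \<psi> y)"
        using mono[of 0 s] mono[of s y] that \<psi>(1) by (auto simp: indicator_def)
    qed
  qed (use meas[OF that] in \<open>simp add: set_borel_measurable_def\<close>)
  have const: "(LINT s:{x..y}|lborel. c) = c * (y - x)" if "x \<le> y" for c x y :: real
    using that by (simp add: set_lebesgue_integral_def)
  have incr: "\<Psi> y - \<Psi> x = (LINT s:{x..y}|lborel. \<psi> s)" if "0 \<le> x" "x \<le> y" for x y
  proof -
    have "(LINT s:{0..x} \<union> {x..y}|lborel. \<psi> s) = (LINT s:{0..x}|lborel. \<psi> s) + (LINT s:{x..y}|lborel. \<psi> s)"
    proof (rule set_integral_Un_AE)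
      show "AE s in lborel. \<not> (s \<in> {0..x} \<and> s \<in> {x..y})"
        using AE_lborel_singleton[of x] by eventually_elim auto
    qed (use int that in auto)
    moreover have "{0..x} \<union> {x..y} = {0..y}" using that by auto
    ultimately show ?thesis using \<Psi> that by simp
  qed
  have c_int: "set_integrable lborel {x..y} (\<lambda>s. c)" for x y c :: real
    unfolding set_integrable_def
    by (intro integrable_scaleR_left integrable_real_indicator) (auto simp: emeasure_lborel_Icc_eq)
  show thesis
  proof (rule that[OF \<psi>])
    show "\<psi> x * (y - x) \<le> \<Psi> y - \<Psi> x" if "0 \<le> x" "x \<le> y" for x y
      unfolding incr[OF that] const[OF that(2), symmetric]
      using that mono by (intro set_integral_mono int c_int) auto
    show "\<Psi> y - \<Psi> x \<le> \<psi> y * (y - x)" if "0 \<le> x" "x \<le> y" for x y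
      unfolding incr[OF that] const[OF that(2), symmetric]
      using that mono by (intro set_integral_mono int c_int) auto
  qed
qed

lemma young_function_zero:
  assumes "young_function \<Psi>" shows "\<Psi> 0 = 0"
proof -
  obtain \<psi> where "\<psi> 0 = 0" "\<And>t. t \<ge> 0 \<Longrightarrow> \<Psi> t = (LINT s:{0..t}|lborel. \<psi> s)"
    using assms unfolding young_function_def by blast
  moreover have "(\<lambda>s. indicat_real {0..0} s *\<^sub>R \<psi> s) = (\<lambda>s. 0)"
    using \<open>\<psi> 0 = 0\<close> by (auto simp: indicator_def)
  ultimately show ?thesis unfolding set_lebesgue_integral_def by simp
qed

lemma young_function_strict_mono:
  assumes "young_function \<Psi>" "0 \<le> x" "x < y" shows "\<Psi> x < \<Psi> y"
proof -
  obtain \<psi> where \<psi>: "\<psi> 0 = 0" "\<And>s. s > 0 \<Longrightarrow> \<psi> s > 0" "mono_on {0..} \<psi>" "filterlim \<psi> at_top at_top"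
    "\<And>x y. 0 \<le> x \<Longrightarrow> x \<le> y \<Longrightarrow> \<psi> x * (y - x) \<le> \<Psi> y - \<Psi> x"
    "\<And>x y. 0 \<le> x \<Longrightarrow> x \<le> y \<Longrightarrow> \<Psi> y - \<Psi> x \<le> \<psi> y * (y - x)"
    by (rule young_function_increment[OF assms(1)]) (rule that; blast)
  let ?m = "(x + y) / 2"
  have m: "x < ?m" "?m < y" using assms(3) by (auto simp: field_simps)
  have "0 \<le> \<psi> x" using mono_onD[OF \<psi>(3), of 0 x] \<psi>(1) assms(2) by simp
  have "0 < \<psi> ?m * (y - ?m)" using \<psi>(2)[of ?m] m assms(2) by (intro mult_pos_pos) linarith+
  also have "\<dots> \<le> \<Psi> y - \<Psi> ?m" using \<psi>(5)[of ?m y] m assms(2) by linarith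
  finally have "\<Psi> ?m < \<Psi> y" by simp
  moreover have "0 \<le> \<psi> x * (?m - x)"
    using \<open>0 \<le> \<psi> x\<close> m by simp
  ultimately show ?thesis using \<psi>(5)[of x ?m] m assms(2) by linarith
qed

lemma young_function_mono:
  assumes "young_function \<Psi>" "0 \<le> x" "x \<le> y" shows "\<Psi> x \<le> \<Psi> y"
  using young_function_strict_mono[OF assms(1,2), of y] assms(3) by (cases "x = y") auto

lemma young_function_abs_nonneg: "young_function \<Psi> \<Longrightarrow> \<Psi> \<bar>x\<bar> \<ge> 0"
  using young_function_mono[of \<Psi> 0 "\<bar>x\<bar>"] by (simp add: young_function_zero)

lemma young_function_midpoint_nonneg:
  assumes "young_function \<Psi>" "0 \<le> x" "0 \<le> y" shows "\<Psi> ((x + y) / 2) \<le> (\<Psi> x + \<Psi> y) / 2"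
proof -
  obtain \<psi> where \<psi>: "\<psi> 0 = 0" "\<And>s. s > 0 \<Longrightarrow> \<psi> s > 0" "mono_on {0..} \<psi>" "filterlim \<psi> at_top at_top"
    "\<And>x y. 0 \<le> x \<Longrightarrow> x \<le> y \<Longrightarrow> \<psi> x * (y - x) \<le> \<Psi> y - \<Psi> x"
    "\<And>x y. 0 \<le> x \<Longrightarrow> x \<le> y \<Longrightarrow> \<Psi> y - \<Psi> x \<le> \<psi> y * (y - x)"
    by (rule young_function_increment[OF assms(1)]) (rule that; blast)
  have *: "\<Psi> ((x + y) / 2) \<le> (\<Psi> x + \<Psi> y) / 2" if "0 \<le> x" "x \<le> y" for x y
  proof -
    let ?m = "(x + y) / 2"
    have m: "x \<le> ?m" "?m \<le> y" "?m - x = y - ?m" using that by (auto simp: field_simps)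
    have "\<Psi> ?m - \<Psi> x \<le> \<psi> ?m * (y - ?m)" using \<psi>(6)[of x ?m] m(1) that unfolding m(3) by simp
    also have "\<dots> \<le> \<Psi> y - \<Psi> ?m" using \<psi>(5)[of ?m y] m that by linarith
    finally show ?thesis by (simp add: field_simps)
  qed
  show ?thesis
    using *[of x y] *[of y x] assms by (cases "x \<le> y") (auto simp: add.commute)
qed

lemma young_function_abs_midpoint:
  assumes "young_function \<Psi>" shows "\<Psi> \<bar>(x + y) / 2\<bar> \<le> (\<Psi> \<bar>x\<bar> + \<Psi> \<bar>y\<bar>) / 2"
proof -
  have "\<Psi> \<bar>(x + y) / 2\<bar> \<le> \<Psi> ((\<bar>x\<bar> + \<bar>y\<bar>) / 2)"
    by (rule young_function_mono[OF assms]) (auto simp: abs_triangle_ineq divide_right_mono)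
  also have "\<dots> \<le> (\<Psi> \<bar>x\<bar> + \<Psi> \<bar>y\<bar>) / 2"
    by (rule young_function_midpoint_nonneg[OF assms]) auto
  finally show ?thesis .
qed

text \<open>Strict convexity on the half line passes to \<open>x \<mapsto> \<Psi> \<bar>x\<bar>\<close> on the line: the only pairs of distinct points
  with equal absolute value are \<open>x\<close> and \<open>-x\<close>, whose midpoint \<open>0\<close> is the strict minimum point.\<close>

lemma young_function_abs_midpoint_strict:
  assumes \<Psi>: "young_function \<Psi>" and strict: "strictly_convex_on {0..} \<Psi>" and "x \<noteq> y"
  shows "\<Psi> \<bar>(x + y) / 2\<bar> < (\<Psi> \<bar>x\<bar> + \<Psi> \<bar>y\<bar>) / 2"
proof (cases "\<bar>x\<bar> = \<bar>y\<bar>")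
  case True
  then have "x + y = 0" "\<bar>x\<bar> > 0" using assms(3) by (auto simp: abs_if split: if_splits)
  then have "\<Psi> \<bar>(x + y) / 2\<bar> = 0" "\<Psi> \<bar>x\<bar> > 0"
    using young_function_strict_mono[OF \<Psi>, of 0 "\<bar>x\<bar>"] by (auto simp: young_function_zero[OF \<Psi>])
  then show ?thesis using True by (simp del: zero_less_abs_iff)
next
  case False
  have "\<Psi> \<bar>(x + y) / 2\<bar> \<le> \<Psi> ((\<bar>x\<bar> + \<bar>y\<bar>) / 2)"
    by (rule young_function_mono[OF \<Psi>]) (auto simp: abs_triangle_ineq divide_right_mono)
  also have "\<dots> < (\<Psi> \<bar>x\<bar> + \<Psi> \<bar>y\<bar>) / 2"
    using strict False by (intro strictly_convex_on_midpoint) auto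
  finally show ?thesis .
qed

lemma young_function_abs_continuous:
  assumes "young_function \<Psi>" shows "continuous_on UNIV (\<lambda>x. \<Psi> \<bar>x\<bar>)"
proof -
  obtain \<psi> where \<psi>: "\<psi> 0 = 0" "\<And>s. s > 0 \<Longrightarrow> \<psi> s > 0" "mono_on {0..} \<psi>" "filterlim \<psi> at_top at_top"
    "\<And>x y. 0 \<le> x \<Longrightarrow> x \<le> y \<Longrightarrow> \<psi> x * (y - x) \<le> \<Psi> y - \<Psi> x"
    "\<And>x y. 0 \<le> x \<Longrightarrow> x \<le> y \<Longrightarrow> \<Psi> y - \<Psi> x \<le> \<psi> y * (y - x)"
    by (rule young_function_increment[OF assms]) (rule that; blast)
  have lip: "\<bar>\<Psi> \<bar>y\<bar> - \<Psi> \<bar>x\<bar>\<bar> \<le> \<psi> R * \<bar>\<bar>y\<bar> - \<bar>x\<bar>\<bar>" if R: "\<bar>x\<bar> \<le> R" "\<bar>y\<bar> \<le> R" for x y R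
  proof -
    have *: "\<bar>\<Psi> b - \<Psi> a\<bar> \<le> \<psi> R * (b - a)" if "0 \<le> a" "a \<le> b" "b \<le> R" for a b
    proof -
      have "\<Psi> b - \<Psi> a \<le> \<psi> b * (b - a)" using \<psi>(6) that by auto
      also have "\<dots> \<le> \<psi> R * (b - a)"
        using mono_onD[OF \<psi>(3), of b R] that by (intro mult_right_mono) auto
      finally show ?thesis using young_function_mono[OF assms that(1,2)] by simp
    qed
    show ?thesis using *[of "\<bar>x\<bar>" "\<bar>y\<bar>"] *[of "\<bar>y\<bar>" "\<bar>x\<bar>"] R
      by (cases "\<bar>x\<bar> \<le> \<bar>y\<bar>") (auto simp: abs_minus_commute)
  qed
  have "isCont (\<lambda>x. \<Psi> \<bar>x\<bar>) x" for x
    unfolding isCont_def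
  proof (rule LIM_zero_cancel, rule Lim_null_comparison)
    have "\<forall>\<^sub>F y in at x. dist y x < 1" by (simp add: eventually_at_ball' flip: mem_ball) (simp add: eventually_at dist_commute; blast intro: zero_less_one)
    then show "\<forall>\<^sub>F y in at x. norm (\<Psi> \<bar>y\<bar> - \<Psi> \<bar>x\<bar>) \<le> \<psi> (\<bar>x\<bar> + 1) * \<bar>\<bar>y\<bar> - \<bar>x\<bar>\<bar>"
      by eventually_elim (use lip in \<open>auto simp: dist_real_def\<close>)
    have "((\<lambda>y. \<psi> (\<bar>x\<bar> + 1) * \<bar>\<bar>y\<bar> - \<bar>x\<bar>\<bar>) \<longlongrightarrow> \<psi> (\<bar>x\<bar> + 1) * \<bar>\<bar>x\<bar> - \<bar>x\<bar>\<bar>) (at x)"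
      by (intro tendsto_intros)
    then show "((\<lambda>y. \<psi> (\<bar>x\<bar> + 1) * \<bar>\<bar>y\<bar> - \<bar>x\<bar>\<bar>) \<longlongrightarrow> 0) (at x)" by simp
  qed
  then show ?thesis by (simp add: continuous_at_imp_continuous_on)
qed

text \<open>Once the density exceeds \<open>2 \<bar>K\<bar>\<close> at \<open>s\<close>, the function lies above the line of this slope through
  \<open>(s, 0)\<close>, and that line is above \<open>\<bar>K\<bar> t\<close> for \<open>t \<ge> 2 s\<close>.\<close>

lemma young_function_superlinear:
  assumes "young_function \<Psi>" shows "\<exists>R. \<forall>t. \<bar>t\<bar> \<ge> R \<longrightarrow> K * \<bar>t\<bar> \<le> \<Psi> \<bar>t\<bar>"
proof -
  obtain \<psi> where \<psi>: "\<psi> 0 = 0" "\<And>s. s > 0 \<Longrightarrow> \<psi> s > 0" "mono_on {0..} \<psi>" "filterlim \<psi> at_top at_top"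
    "\<And>x y. 0 \<le> x \<Longrightarrow> x \<le> y \<Longrightarrow> \<psi> x * (y - x) \<le> \<Psi> y - \<Psi> x"
    "\<And>x y. 0 \<le> x \<Longrightarrow> x \<le> y \<Longrightarrow> \<Psi> y - \<Psi> x \<le> \<psi> y * (y - x)"
    by (rule young_function_increment[OF assms]) (rule that; blast)
  have "\<forall>\<^sub>F s in at_top. \<psi> s \<ge> 2 * \<bar>K\<bar>" using \<psi>(4) by (simp add: filterlim_at_top)
  then obtain s0 where s0: "\<And>s. s \<ge> s0 \<Longrightarrow> \<psi> s \<ge> 2 * \<bar>K\<bar>" by (auto simp: eventually_at_top_linorder)
  define s where "s = max 0 s0"
  have s: "s \<ge> 0" "\<psi> s \<ge> 2 * \<bar>K\<bar>" using s0 by (auto simp: s_def)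
  have "K * \<bar>t\<bar> \<le> \<Psi> \<bar>t\<bar>" if "\<bar>t\<bar> \<ge> 2 * s" for t
  proof -
    have "K * \<bar>t\<bar> \<le> \<bar>K\<bar> * \<bar>t\<bar>" by (intro mult_right_mono) auto
    also have "\<dots> \<le> \<bar>K\<bar> * (2 * (\<bar>t\<bar> - s))" using that by (intro mult_left_mono) auto
    also have "\<dots> = 2 * \<bar>K\<bar> * (\<bar>t\<bar> - s)" by simp
    also have "\<dots> \<le> \<psi> s * (\<bar>t\<bar> - s)" using s that by (intro mult_right_mono) auto
    also have "\<dots> \<le> \<Psi> \<bar>t\<bar> - \<Psi> s" using \<psi>(5) s that by simp
    also have "\<dots> \<le> \<Psi> \<bar>t\<bar>" using young_function_abs_nonneg[OF assms, of s] s by simp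
    finally show ?thesis .
  qed
  then show ?thesis by blast
qed

section \<open>Lebesgue measure on a time interval\<close>

abbreviation time_measure :: "real \<Rightarrow> real measure" where
  "time_measure T \<equiv> restrict_space lborel {0..T}"

lemma space_time_measure: "space (time_measure T) = {0..T}"
  by (simp add: space_restrict_space)

lemma finite_time_measure: "finite_measure (time_measure T)"
  by (rule finite_measureI) (simp add: emeasure_restrict_space space_restrict_space emeasure_lborel_Icc_eq)

lemma integrable_time_measure_iff:
  fixes u :: "real \<Rightarrow> real"
  shows "integrable (time_measure T) u \<longleftrightarrow> set_integrable lborel {0..T} u"
  by (subst integrable_restrict_space) (auto simp: set_integrable_def)

text \<open>The positive and the negative part of \<open>f\<close> are densities of finite measures that agree on all
  half lines, so the measures are equal and their densities agree almost everywhere.\<close>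

lemma AE_zero_of_integral_Icc_zero:
  fixes f :: "real \<Rightarrow> real"
  assumes f: "integrable lborel f" and supp: "\<And>s. s \<notin> {0..T} \<Longrightarrow> f s = 0"
    and zero: "\<And>t. t \<in> {0..T} \<Longrightarrow> (\<integral>s. indicator {0..t} s * f s \<partial>lborel) = 0"
  shows "AE s in lborel. f s = 0"
proof (cases "T < 0")
  case True
  then show ?thesis using supp by (intro AE_I2) auto
next
  case False
  have [measurable]: "f \<in> borel_measurable borel" using f by auto
  let ?p = "\<lambda>s. ennreal (f s)" and ?n = "\<lambda>s. ennreal (- f s)"
  have fin: "(\<integral>\<^sup>+s. ?p s \<partial>lborel) < \<infinity>" "(\<integral>\<^sup>+s. ?n s \<partial>lborel) < \<infinity>"
    using f by (auto simp: real_integrable_def less_top)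
  have split: "(\<integral>\<^sup>+s. ?p s * indicator A s \<partial>lborel) = (\<integral>\<^sup>+s. ?n s * indicator A s \<partial>lborel)"
    if [measurable]: "A \<in> sets borel" and 0: "(\<integral>s. indicator A s * f s \<partial>lborel) = 0" for A
  proof -
    let ?g = "\<lambda>s. indicator A s * f s"
    have g: "integrable lborel ?g"
      using integrable_mult_indicator[OF _ f, of A] by simp
    have e: "?p s * indicator A s = ennreal (?g s)" "?n s * indicator A s = ennreal (- ?g s)" for s
      by (auto simp: indicator_def)
    have "ennreal (enn2real (\<integral>\<^sup>+s. ennreal (?g s) \<partial>lborel)) = ennreal (enn2real (\<integral>\<^sup>+s. ennreal (- ?g s) \<partial>lborel))"
      using 0 real_lebesgue_integral_def[OF g] by simp
    moreover have "(\<integral>\<^sup>+s. ennreal (?g s) \<partial>lborel) < top" "(\<integral>\<^sup>+s. ennreal (- ?g s) \<partial>lborel) < top"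
      using g by (simp_all add: real_integrable_def less_top)
    ultimately show ?thesis unfolding e by (metis ennreal_enn2real)
  qed
  have tail: "(\<integral>s. indicator {x<..} s * f s \<partial>lborel) = 0" for x
  proof -
    have total: "(\<integral>s. f s \<partial>lborel) = 0"
    proof -
      have "(\<integral>s. f s \<partial>lborel) = (\<integral>s. indicator {0..T} s * f s \<partial>lborel)"
        using supp by (intro Bochner_Integration.integral_cong) (auto simp: indicator_def)
      then show ?thesis using zero[of T] False by simp
    qed
    consider "x < 0" | "x \<in> {0..T}" | "x > T" by fastforce
    then show ?thesis
    proof cases
      case 1
      have "(\<integral>s. indicator {x<..} s * f s \<partial>lborel) = (\<integral>s. f s \<partial>lborel)"
        using supp 1 by (intro Bochner_Integration.integral_cong) (auto simp: indicator_def)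
      then show ?thesis using total by simp
    next
      case 2
      have "(\<integral>s. indicator {x<..} s * f s \<partial>lborel) = (\<integral>s. f s - indicator {0..x} s * f s \<partial>lborel)"
        using supp 2 by (intro Bochner_Integration.integral_cong) (auto simp: indicator_def)
      also have "\<dots> = 0"
        using total zero[OF 2] f integrable_mult_indicator[OF _ f, of "{0..x}"] by simp
      finally show ?thesis .
    next
      case 3
      then have "(\<lambda>s. indicator {x<..} s * f s) = (\<lambda>s. 0)"
        using supp by (auto simp: indicator_def)
      then show ?thesis by simp
    qed
  qed
  have "density lborel ?p = density lborel ?n"
  proof (rule measure_eqI_lessThan)
    fix x
    show "emeasure (density lborel ?p) {x<..} = emeasure (density lborel ?n) {x<..}"
      using split[OF _ tail] by (simp add: emeasure_density)
    have "emeasure (density lborel ?p) {x<..} \<le> (\<integral>\<^sup>+s. ?p s \<partial>lborel)"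
      by (auto simp: emeasure_density indicator_def intro!: nn_integral_mono)
    then show "emeasure (density lborel ?p) {x<..} < \<infinity>" using fin(1) by (rule le_less_trans)
  qed auto
  then have "AE s in lborel. ?p s = ?n s"
    by (subst (asm) sigma_finite_measure.density_unique_iff[OF sigma_finite_lborel]) auto
  then show ?thesis
  proof eventually_elim
    case (elim s)
    then show ?case by (cases "f s \<ge> 0") (auto simp: ennreal_neg ennreal_eq_0_iff)
  qed
qed

lemma continuous_on_set_integral_Icc:
  fixes f :: "real \<Rightarrow> real"
  assumes "set_integrable lborel {0..T} f"
  shows "continuous_on {0..T} (\<lambda>t. LINT s:{0..t}|lborel. f s)"
proof -
  have "f integrable_on {0..T}" using set_borel_integral_eq_integral(1)[OF assms] .
  then have "continuous_on {0..T} (\<lambda>t. integral {0..t} f)" by (rule indefinite_integral_continuous_1)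
  moreover have "(LINT s:{0..t}|lborel. f s) = integral {0..t} f" if "t \<in> {0..T}" for t
    using that by (intro set_borel_integral_eq_integral(2) set_integrable_subset[OF assms]) auto
  ultimately show ?thesis using continuous_on_cong[OF refl, of "{0..T}" "\<lambda>t. LINT s:{0..t}|lborel. f s"] by simp
qed

text \<open>The zero set is closed and meets every subinterval, since intervals have positive measure.\<close>

lemma continuous_zero_of_AE_zero:
  fixes g :: "real \<Rightarrow> real"
  assumes "T > 0" and g: "continuous_on {0..T} g" and ae: "AE t in lborel. t \<in> {0..T} \<longrightarrow> g t = 0"
    and t: "t \<in> {0..T}"
  shows "g t = 0"
proof -
  let ?Z = "{t \<in> {0..T}. g t = 0}"
  have "closed ?Z" by (intro continuous_closed_preimage_constant g closed_atLeastAtMost)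
  moreover have "t \<in> closure ?Z"
    unfolding closure_approachable
  proof (intro allI impI)
    fix e :: real assume "e > 0"
    let ?l = "max 0 (t - e)" and ?r = "min T (t + e)"
    have lr: "?l < ?r" using t \<open>e > 0\<close> \<open>T > 0\<close> by auto
    have "\<exists>y\<in>{?l<..<?r}. g y = 0"
    proof (rule ccontr)
      assume neg: "\<not> (\<exists>y\<in>{?l<..<?r}. g y = 0)"
      have "AE y in lborel. y \<notin> {?l<..<?r}"
        using ae by eventually_elim (use neg in auto)
      then have "{?l<..<?r} \<in> null_sets lborel" by (subst AE_iff_null_sets) auto
      then have "emeasure lborel {?l<..<?r} = 0" by (rule null_setsD1)
      moreover have "emeasure lborel {?l<..<?r} = ennreal (?r - ?l)"
        using lr by (intro emeasure_lborel_Ioo) (rule less_imp_le)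
      ultimately have "ennreal (?r - ?l) = 0" by simp
      then show False using lr unfolding ennreal_eq_0_iff by linarith
    qed
    then obtain y where "y \<in> {?l<..<?r}" "g y = 0" by blast
    then show "\<exists>y\<in>?Z. dist y t < e" by (intro bexI[of _ y]) (auto simp: dist_real_def)
  qed
  ultimately show ?thesis using closure_closed by blast
qed

text \<open>A process with continuous paths is the pointwise limit of its values at the grid points
  \<open>\<lfloor>n t\<rfloor> / n\<close>, and these are jointly measurable because the grid is countable.\<close>

lemma measurable_of_continuous_paths:
  fixes f :: "real \<Rightarrow> 'a \<Rightarrow> real"
  assumes f: "\<And>t. t \<in> {0..T} \<Longrightarrow> f t \<in> borel_measurable M" and "T \<ge> 0"
    and cont: "\<And>\<omega>. \<omega> \<in> space M \<Longrightarrow> continuous_on {0..T} (\<lambda>t. f t \<omega>)"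
  shows "(\<lambda>(t, \<omega>). f t \<omega>) \<in> borel_measurable (time_measure T \<Otimes>\<^sub>M M)"
proof -
  let ?Q = "time_measure T \<Otimes>\<^sub>M M"
  have id: "(\<lambda>x. x) \<in> time_measure T \<rightarrow>\<^sub>M borel" by (rule measurable_restrict_space1) simp
  have fst_m [measurable]: "(\<lambda>q. fst q) \<in> borel_measurable ?Q" by (rule measurable_compose[OF measurable_fst id])
  \<comment> \<open>For \<open>t\<close> in the interval the grid point lies in it as well; the truncation only makes the function total.\<close>
  define grid :: "nat \<Rightarrow> int \<Rightarrow> real" where "grid n i = max 0 (min T (of_int i / real (Suc n)))" for n i
  have grid: "grid n i \<in> {0..T}" for n i using \<open>T \<ge> 0\<close> by (auto simp: grid_def)
  have near: "\<bar>grid n \<lfloor>real (Suc n) * t\<rfloor> - t\<bar> \<le> 1 / real (Suc n)" if "t \<in> {0..T}" for n t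
  proof -
    let ?r = "of_int \<lfloor>real (Suc n) * t\<rfloor> / real (Suc n)"
    have "?r \<le> t" by (simp add: divide_le_eq) (metis mult.commute of_int_floor_le)
    moreover have "0 \<le> ?r" using that by (intro divide_nonneg_pos) auto
    moreover have "t - ?r \<le> 1 / real (Suc n)"
    proof -
      have "real (Suc n) * t \<le> of_int \<lfloor>real (Suc n) * t\<rfloor> + 1" by linarith
      then have "t \<le> (of_int \<lfloor>real (Suc n) * t\<rfloor> + 1) / real (Suc n)" by (simp add: field_simps)
      then show ?thesis by (simp add: add_divide_distrib)
    qed
    ultimately show ?thesis using that by (auto simp: grid_def)
  qed
  show ?thesis
  proof (rule borel_measurable_LIMSEQ_metric)
    fix n
    show "(\<lambda>q. f (grid n \<lfloor>real (Suc n) * fst q\<rfloor>) (snd q)) \<in> borel_measurable ?Q"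
    proof (rule measurable_compose_countable)
      show "(\<lambda>q. f (grid n i) (snd q)) \<in> borel_measurable ?Q" for i
        by (rule measurable_compose[OF measurable_snd f[OF grid]])
      show "(\<lambda>q. \<lfloor>real (Suc n) * fst q\<rfloor>) \<in> ?Q \<rightarrow>\<^sub>M count_space UNIV" by measurable
    qed
  next
    fix q assume "q \<in> space ?Q"
    then have q: "fst q \<in> {0..T}" "snd q \<in> space M" by (auto simp: space_pair_measure space_time_measure)
    have "(\<lambda>n. grid n \<lfloor>real (Suc n) * fst q\<rfloor> - fst q) \<longlonglongrightarrow> 0"
      by (rule Lim_null_comparison[OF _ LIMSEQ_Suc[OF lim_const_over_n[of 1]]]) (use near[OF q(1)] in \<open>auto intro!: always_eventually\<close>)
    then have "(\<lambda>n. grid n \<lfloor>real (Suc n) * fst q\<rfloor>) \<longlonglongrightarrow> fst q" by (rule LIM_zero_cancel)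
    from continuous_on_tendsto_compose[OF cont[OF q(2)] this q(1)]
    show "(\<lambda>n. f (grid n \<lfloor>real (Suc n) * fst q\<rfloor>) (snd q)) \<longlonglongrightarrow> (case q of (t, \<omega>) \<Rightarrow> f t \<omega>)"
      using grid by (simp add: split_def)
  qed
qed

section \<open>States driven by a pathwise Volterra integral\<close>

text \<open>Here \<open>H\<close> stands for \<open>G e\<^sup>A\<close> and \<open>Z\<close> for \<open>z\<close>, both already modified on a null set, so that the
  regularity of the paths holds for every \<open>\<omega>\<close> and each pathwise integral converges.\<close>

locale linear_state = prob_space M for M :: "'a measure" +
  fixes T :: real and H Z :: "real \<Rightarrow> 'a \<Rightarrow> real"
  assumes T_nonneg: "T \<ge> 0"
    and H_measurable: "(\<lambda>(t, \<omega>). H t \<omega>) \<in> borel_measurable (time_measure T \<Otimes>\<^sub>M M)"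
    and H_continuous: "\<And>\<omega>. \<omega> \<in> space M \<Longrightarrow> continuous_on {0..T} (\<lambda>t. H t \<omega>)"
    and H_pos: "\<And>t \<omega>. t \<in> {0..T} \<Longrightarrow> \<omega> \<in> space M \<Longrightarrow> H t \<omega> > 0"
    and Z_measurable: "(\<lambda>(t, \<omega>). Z t \<omega>) \<in> borel_measurable (time_measure T \<Otimes>\<^sub>M M)"
    and Z_integrable: "\<And>\<omega>. \<omega> \<in> space M \<Longrightarrow> integrable (time_measure T) (\<lambda>s. Z s \<omega>)"
begin

definition \<xi> :: "(real \<Rightarrow> real) \<Rightarrow> real \<Rightarrow> 'a \<Rightarrow> real" where
  "\<xi> u t \<omega> = H t \<omega> * (\<integral>s. indicator {0..t} s / H s \<omega> * (Z s \<omega> - u s) \<partial>time_measure T)"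

sublocale time: finite_measure "time_measure T" by (rule finite_time_measure)

sublocale pair: pair_sigma_finite "time_measure T" M
  by unfold_locales

lemma \<xi>_measurable:
  assumes [measurable]: "u \<in> borel_measurable (time_measure T)"
  shows "(\<lambda>(t, \<omega>). \<xi> u t \<omega>) \<in> borel_measurable (time_measure T \<Otimes>\<^sub>M M)"
proof -
  note [measurable] = H_measurable Z_measurable
  have [measurable]: "(\<lambda>q. H (snd q) (snd (fst q))) \<in> borel_measurable ((time_measure T \<Otimes>\<^sub>M M) \<Otimes>\<^sub>M time_measure T)"
    using measurable_compose[OF _ H_measurable, of "\<lambda>q. (snd q, snd (fst q))" "(time_measure T \<Otimes>\<^sub>M M) \<Otimes>\<^sub>M time_measure T"]
    by simp
  have [measurable]: "(\<lambda>q. Z (snd q) (snd (fst q))) \<in> borel_measurable ((time_measure T \<Otimes>\<^sub>M M) \<Otimes>\<^sub>M time_measure T)"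
    using measurable_compose[OF _ Z_measurable, of "\<lambda>q. (snd q, snd (fst q))" "(time_measure T \<Otimes>\<^sub>M M) \<Otimes>\<^sub>M time_measure T"]
    by simp
  have id [measurable]: "(\<lambda>x. x) \<in> time_measure T \<rightarrow>\<^sub>M borel" by (rule measurable_restrict_space1) simp
  have fst_m [measurable]: "(\<lambda>q. fst (fst q)) \<in> borel_measurable ((time_measure T \<Otimes>\<^sub>M M) \<Otimes>\<^sub>M time_measure T)"
    by (rule measurable_compose[OF _ id]) measurable
  have snd_m [measurable]: "(\<lambda>q. snd q) \<in> borel_measurable ((time_measure T \<Otimes>\<^sub>M M) \<Otimes>\<^sub>M time_measure T)"
    by (rule measurable_compose[OF _ id]) measurable
  have ind: "(\<lambda>q. indicator {0..fst (fst q)} (snd q) :: real) \<in> borel_measurable ((time_measure T \<Otimes>\<^sub>M M) \<Otimes>\<^sub>M time_measure T)"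
    unfolding indicator_def atLeastAtMost_iff by measurable
  have "(\<lambda>q. indicator {0..fst (fst q)} (snd q) / H (snd q) (snd (fst q)) * (Z (snd q) (snd (fst q)) - u (snd q)))
     \<in> borel_measurable ((time_measure T \<Otimes>\<^sub>M M) \<Otimes>\<^sub>M time_measure T)"
    using ind by measurable
  then have "(\<lambda>x. (\<integral>s. indicator {0..fst x} s / H s (snd x) * (Z s (snd x) - u s) \<partial>time_measure T))
      \<in> borel_measurable (time_measure T \<Otimes>\<^sub>M M)"
    by (intro time.borel_measurable_lebesgue_integral) (simp add: split_def)
  then show ?thesis unfolding \<xi>_def split_def using H_measurable by (simp add: split_def)
qed

lemma kernel_bound:
  assumes "\<omega> \<in> space M"
  obtains K where "K > 0" "\<And>s. s \<in> {0..T} \<Longrightarrow> \<bar>1 / H s \<omega>\<bar> \<le> K"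
proof -
  have "continuous_on {0..T} (\<lambda>s. 1 / H s \<omega>)"
    using H_pos[OF _ assms] by (intro continuous_intros H_continuous[OF assms]) force
  from compact_continuous_image[OF this compact_Icc, THEN compact_imp_bounded]
  obtain K where "K > 0" "\<forall>x\<in>(\<lambda>s. 1 / H s \<omega>) ` {0..T}. norm x \<le> K" by (auto simp: bounded_pos)
  then show thesis by (intro that) auto
qed

lemma kernel_integrable:
  assumes "\<omega> \<in> space M" and f: "integrable (time_measure T) f"
  shows "integrable (time_measure T) (\<lambda>s. indicator {0..t} s / H s \<omega> * f s)"
proof -
  obtain K where K: "K > 0" "\<And>s. s \<in> {0..T} \<Longrightarrow> \<bar>1 / H s \<omega>\<bar> \<le> K" using kernel_bound[OF assms(1)] by blast
  have [measurable]: "(\<lambda>s. H s \<omega>) \<in> borel_measurable (time_measure T)"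
    using measurable_Pair_compose_split[OF H_measurable measurable_ident measurable_const[OF assms(1)]] by (simp add: id_def)
  have [measurable]: "f \<in> borel_measurable (time_measure T)" using f by auto
  have id [measurable]: "(\<lambda>x. x) \<in> time_measure T \<rightarrow>\<^sub>M borel" by (rule measurable_restrict_space1) simp
  show ?thesis
  proof (rule Bochner_Integration.integrable_bound)
    show "integrable (time_measure T) (\<lambda>s. K * f s)" using f by simp
    show "AE s in time_measure T. norm (indicator {0..t} s / H s \<omega> * f s) \<le> norm (K * f s)"
    proof (intro AE_I2)
      fix s assume "s \<in> space (time_measure T)"
      then have "\<bar>indicator {0..t} s / H s \<omega>\<bar> \<le> K"
        using K(1) K(2)[of s] by (auto simp: indicator_def space_time_measure)
      then have "\<bar>indicator {0..t} s / H s \<omega>\<bar> * \<bar>f s\<bar> \<le> K * \<bar>f s\<bar>"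
        by (rule mult_right_mono) simp
      then show "norm (indicator {0..t} s / H s \<omega> * f s) \<le> norm (K * f s)"
        using K(1) by (simp only: real_norm_def abs_mult abs_of_pos)
    qed
  qed measurable
qed

lemma \<xi>_diff:
  assumes "\<omega> \<in> space M" "integrable (time_measure T) u" "integrable (time_measure T) v"
  shows "\<xi> u t \<omega> - \<xi> v t \<omega> = - H t \<omega> * (\<integral>s. indicator {0..t} s / H s \<omega> * (u s - v s) \<partial>time_measure T)"
proof -
  have *: "integrable (time_measure T) (\<lambda>s. indicator {0..t} s / H s \<omega> * (Z s \<omega> - w s))"
    if "integrable (time_measure T) w" for w
    using that Z_integrable assms(1) by (intro kernel_integrable) auto
  have "(\<integral>s. indicator {0..t} s / H s \<omega> * (u s - v s) \<partial>time_measure T)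
     = (\<integral>s. indicator {0..t} s / H s \<omega> * (Z s \<omega> - v s) - indicator {0..t} s / H s \<omega> * (Z s \<omega> - u s) \<partial>time_measure T)"
    by (intro Bochner_Integration.integral_cong refl) algebra
  also have "\<dots> = (\<integral>s. indicator {0..t} s / H s \<omega> * (Z s \<omega> - v s) \<partial>time_measure T)
      - (\<integral>s. indicator {0..t} s / H s \<omega> * (Z s \<omega> - u s) \<partial>time_measure T)"
    by (intro Bochner_Integration.integral_diff * assms)
  finally have *: "(\<integral>s. indicator {0..t} s / H s \<omega> * (u s - v s) \<partial>time_measure T) = \<dots>" .
  show ?thesis unfolding \<xi>_def * by algebra
qed

lemma \<xi>_midpoint:
  assumes "\<omega> \<in> space M" "integrable (time_measure T) u" "integrable (time_measure T) v"
  shows "\<xi> (\<lambda>s. (u s + v s) / 2) t \<omega> = (\<xi> u t \<omega> + \<xi> v t \<omega>) / 2"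
proof -
  let ?w = "\<lambda>s. (u s + v s) / 2"
  have "\<xi> u t \<omega> - \<xi> ?w t \<omega> = - H t \<omega> * (\<integral>s. indicator {0..t} s / H s \<omega> * (u s - ?w s) \<partial>time_measure T)"
    using assms by (intro \<xi>_diff) auto
  also have "(\<integral>s. indicator {0..t} s / H s \<omega> * (u s - ?w s) \<partial>time_measure T)
    = (\<integral>s. indicator {0..t} s / H s \<omega> * (?w s - v s) \<partial>time_measure T)"
    by (intro Bochner_Integration.integral_cong) (auto simp: field_simps)
  also have "- H t \<omega> * \<dots> = \<xi> ?w t \<omega> - \<xi> v t \<omega>"
    using assms by (intro \<xi>_diff[symmetric]) auto
  finally show ?thesis by (simp add: field_simps)
qed

text \<open>On a fixed path the kernel \<open>1 / H\<close> is bounded by compactness, so the difference of the states at time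
  \<open>t\<close> is at most a constant times the distance of the controls in norm.\<close>

lemma \<xi>_tendsto:
  assumes "\<omega> \<in> space M" "\<And>n. integrable (time_measure T) (s n)" "integrable (time_measure T) u"
    and L1: "(\<lambda>n. \<integral>x. \<bar>s n x - u x\<bar> \<partial>time_measure T) \<longlonglongrightarrow> 0"
  shows "(\<lambda>n. \<xi> (s n) t \<omega>) \<longlonglongrightarrow> \<xi> u t \<omega>"
proof -
  obtain K where K: "K > 0" "\<And>s. s \<in> {0..T} \<Longrightarrow> \<bar>1 / H s \<omega>\<bar> \<le> K" using kernel_bound[OF assms(1)] by blast
  have bound: "\<forall>\<^sub>F n in sequentially. norm (\<xi> (s n) t \<omega> - \<xi> u t \<omega>)
      \<le> \<bar>H t \<omega>\<bar> * (K * (\<integral>x. \<bar>s n x - u x\<bar> \<partial>time_measure T))"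
  proof (intro always_eventually allI)
    fix n
    have "\<bar>\<integral>x. indicator {0..t} x / H x \<omega> * (s n x - u x) \<partial>time_measure T\<bar>
       \<le> (\<integral>x. \<bar>indicator {0..t} x / H x \<omega> * (s n x - u x)\<bar> \<partial>time_measure T)"
      by (rule integral_abs_bound)
    also have "\<dots> \<le> (\<integral>x. K * \<bar>s n x - u x\<bar> \<partial>time_measure T)"
    proof (rule integral_mono)
      fix x assume "x \<in> space (time_measure T)"
      then have "\<bar>indicator {0..t} x / H x \<omega>\<bar> \<le> K"
        using K(1) K(2)[of x] by (auto simp: indicator_def space_time_measure)
      then show "\<bar>indicator {0..t} x / H x \<omega> * (s n x - u x)\<bar> \<le> K * \<bar>s n x - u x\<bar>"
        unfolding abs_mult by (rule mult_right_mono) simp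
    qed (use assms in \<open>auto intro!: integrable_abs kernel_integrable simp del: times_divide_eq_left\<close>)
    finally show "norm (\<xi> (s n) t \<omega> - \<xi> u t \<omega>)
      \<le> \<bar>H t \<omega>\<bar> * (K * (\<integral>x. \<bar>s n x - u x\<bar> \<partial>time_measure T))"
      unfolding \<xi>_diff[OF assms(1,2,3)] by (simp add: abs_mult mult_left_mono)
  qed
  have "(\<lambda>n. \<bar>H t \<omega>\<bar> * (K * (\<integral>x. \<bar>s n x - u x\<bar> \<partial>time_measure T))) \<longlonglongrightarrow> \<bar>H t \<omega>\<bar> * (K * 0)"
    by (intro tendsto_intros L1)
  then have "(\<lambda>n. \<bar>H t \<omega>\<bar> * (K * (\<integral>x. \<bar>s n x - u x\<bar> \<partial>time_measure T))) \<longlonglongrightarrow> 0" by simp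
  with bound show ?thesis by (rule LIM_zero_cancel[OF Lim_null_comparison])
qed

text \<open>By Fubini almost every path sees equal states at almost every time; fix one of them. The
  difference of the states is \<open>-H t\<close> times the primitive of \<open>(u - v) / H\<close>, so this continuous primitive
  vanishes identically, hence so does its density.\<close>

lemma AE_eq_of_\<xi>_eq:
  assumes "T > 0" and u: "integrable (time_measure T) u" and v: "integrable (time_measure T) v"
    and eq: "AE q in time_measure T \<Otimes>\<^sub>M M. \<xi> u (fst q) (snd q) = \<xi> v (fst q) (snd q)"
  shows "AE s in time_measure T. u s = v s"
proof -
  have [measurable]: "u \<in> borel_measurable (time_measure T)" "v \<in> borel_measurable (time_measure T)"
    using u v by auto
  have m: "(\<lambda>q. \<xi> w (fst q) (snd q)) \<in> borel_measurable (time_measure T \<Otimes>\<^sub>M M)"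
    if "w \<in> borel_measurable (time_measure T)" for w
    using \<xi>_measurable[OF that] by (simp add: split_def)
  note [measurable] = m[OF \<open>u \<in> _\<close>] m[OF \<open>v \<in> _\<close>]
  have "AE t in time_measure T. AE \<omega> in M. \<xi> u t \<omega> = \<xi> v t \<omega>"
    using pair.AE_pair[OF eq] by simp
  then have "AE \<omega> in M. AE t in time_measure T. \<xi> u t \<omega> = \<xi> v t \<omega>"
    by (subst (asm) pair.AE_commute) measurable
  then have "AE \<omega> in M. \<omega> \<in> space M \<and> (AE t in time_measure T. \<xi> u t \<omega> = \<xi> v t \<omega>)"
    using AE_space by eventually_elim auto
  moreover have "ae_filter M \<noteq> bot" by (simp add: ae_filter_eq_bot_iff emeasure_space_1)
  ultimately obtain \<omega> where \<omega>: "\<omega> \<in> space M" and ae: "AE t in time_measure T. \<xi> u t \<omega> = \<xi> v t \<omega>"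
    using eventually_happens' by blast
  define h where "h s = indicator {0..T} s * (1 / H s \<omega> * (u s - v s))" for s
  have "integrable (time_measure T) (\<lambda>s. indicator {0..T} s / H s \<omega> * (u s - v s))"
    using u v by (intro kernel_integrable \<omega>) auto
  then have "integrable lborel (\<lambda>s. indicator {0..T} s *\<^sub>R (indicator {0..T} s / H s \<omega> * (u s - v s)))"
    by (subst (asm) integrable_restrict_space) simp_all
  also have "(\<lambda>s. indicator {0..T} s *\<^sub>R (indicator {0..T} s / H s \<omega> * (u s - v s))) = h"
    by (auto simp: h_def indicator_def fun_eq_iff)
  finally have h: "integrable lborel h" .
  have I: "(\<integral>s. indicator {0..t} s / H s \<omega> * (u s - v s) \<partial>time_measure T) = (LINT s:{0..t}|lborel. h s)" for t
    unfolding set_lebesgue_integral_def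
    by (subst integral_restrict_space) (auto simp: h_def indicator_def intro!: Bochner_Integration.integral_cong)
  have cont: "continuous_on {0..T} (\<lambda>t. LINT s:{0..t}|lborel. h s)"
    using integrable_mult_indicator[OF _ h, of "{0..T}"] by (intro continuous_on_set_integral_Icc) (simp add: set_integrable_def)
  have "AE t in lborel. t \<in> {0..T} \<longrightarrow> \<xi> u t \<omega> = \<xi> v t \<omega>"
    using ae by (subst (asm) AE_restrict_space_iff) auto
  then have "AE t in lborel. t \<in> {0..T} \<longrightarrow> (LINT s:{0..t}|lborel. h s) = 0"
  proof eventually_elim
    case (elim t)
    show ?case
    proof
      assume t: "t \<in> {0..T}"
      then have "H t \<omega> * (LINT s:{0..t}|lborel. h s) = 0"
        using \<xi>_diff[OF \<omega> u v, of t] elim unfolding I by simp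
      then show "(LINT s:{0..t}|lborel. h s) = 0" using H_pos[OF t \<omega>] by simp
    qed
  qed
  note zero = continuous_zero_of_AE_zero[OF \<open>T > 0\<close> cont this]
  have "AE s in lborel. h s = 0"
  proof (rule AE_zero_of_integral_Icc_zero[OF h])
    show "h s = 0" if "s \<notin> {0..T}" for s using that by (simp add: h_def)
    show "(\<integral>s. indicator {0..t} s * h s \<partial>lborel) = 0" if "t \<in> {0..T}" for t
      using zero[OF that] by (simp add: set_lebesgue_integral_def)
  qed
  then show ?thesis
    unfolding AE_restrict_space_iff[of "{0..T}" lborel, simplified]
  proof eventually_elim
    case (elim s)
    then show ?case using H_pos[OF _ \<omega>, of s] by (auto simp: h_def)
  qed
qed

end

locale convex_state_cost = linear_state M T H Z
  for M :: "'a measure" and T :: real and H Z :: "real \<Rightarrow> 'a \<Rightarrow> real" +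
  fixes F :: "real \<Rightarrow> real \<Rightarrow> real"
  assumes F_measurable: "(\<lambda>(t, x). F t x) \<in> borel_measurable (restrict_space borel ({0..T} \<times> UNIV))"
    and F_nonneg: "\<And>t x. t \<in> {0..T} \<Longrightarrow> F t x \<ge> 0"
    and F_continuous: "\<And>t. t \<in> {0..T} \<Longrightarrow> continuous_on UNIV (F t)"
    and F_convex: "\<And>t. t \<in> {0..T} \<Longrightarrow> convex_on UNIV (F t)"
begin

abbreviation Q :: "(real \<times> 'a) measure" where "Q \<equiv> time_measure T \<Otimes>\<^sub>M M"

abbreviation running_cost :: "(real \<Rightarrow> real) \<Rightarrow> real \<times> 'a \<Rightarrow> real" where
  "running_cost u q \<equiv> F (fst q) (\<xi> u (fst q) (snd q))"

definition state_cost :: "(real \<Rightarrow> real) \<Rightarrow> ennreal" where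
  "state_cost u = (\<integral>\<^sup>+q. ennreal (running_cost u q) \<partial>Q)"

lemma space_Q: "space Q = {0..T} \<times> space M"
  by (simp add: space_pair_measure space_time_measure)

lemma F_compose_measurable:
  assumes X: "X \<in> borel_measurable Q"
  shows "(\<lambda>q. F (fst q) (X q)) \<in> borel_measurable Q"
proof -
  have id: "(\<lambda>x. x) \<in> time_measure T \<rightarrow>\<^sub>M borel" by (rule measurable_restrict_space1) simp
  have "(\<lambda>q. fst q) \<in> borel_measurable Q" by (rule measurable_compose[OF measurable_fst id])
  then have "(\<lambda>q. (fst q, X q)) \<in> Q \<rightarrow>\<^sub>M borel" using X by (rule borel_measurable_Pair)
  then have "(\<lambda>q. (fst q, X q)) \<in> Q \<rightarrow>\<^sub>M restrict_space borel ({0..T} \<times> UNIV)"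
    by (intro measurable_restrict_space2) (auto simp: space_Q)
  from measurable_compose[OF this F_measurable] show ?thesis by simp
qed

lemma running_cost_measurable:
  assumes "integrable (time_measure T) u" shows "running_cost u \<in> borel_measurable Q"
  using assms \<xi>_measurable[of u] by (intro F_compose_measurable) (auto simp: split_def)

lemma running_cost_nonneg: "q \<in> space Q \<Longrightarrow> running_cost u q \<ge> 0"
  using F_nonneg by (auto simp: space_Q)

lemma F_midpoint: "t \<in> {0..T} \<Longrightarrow> F t ((x + y) / 2) \<le> (F t x + F t y) / 2"
  using convex_onD[OF F_convex, of t "1/2" x y] by (simp add: field_simps)

lemma running_cost_midpoint:
  assumes "q \<in> space Q" "integrable (time_measure T) u" "integrable (time_measure T) v"
  shows "running_cost (\<lambda>s. (u s + v s) / 2) q \<le> (running_cost u q + running_cost v q) / 2"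
  using assms F_midpoint by (auto simp: space_Q \<xi>_midpoint)

lemma state_cost_midpoint:
  assumes "integrable (time_measure T) u" "integrable (time_measure T) v"
  shows "2 * state_cost (\<lambda>s. (u s + v s) / 2) \<le> state_cost u + state_cost v"
  unfolding state_cost_def using assms
  by (intro nn_integral_midpoint running_cost_measurable running_cost_nonneg running_cost_midpoint)

lemma state_cost_lower_semicontinuous:
  assumes s: "\<And>n. integrable (time_measure T) (s n)" "integrable (time_measure T) u"
    "(\<lambda>n. \<integral>x. \<bar>s n x - u x\<bar> \<partial>time_measure T) \<longlonglongrightarrow> 0"
  shows "state_cost u \<le> liminf (\<lambda>n. state_cost (s n))"
  unfolding state_cost_def
proof (intro nn_integral_le_of_AE_tendsto running_cost_measurable s AE_I2)
  fix q assume "q \<in> space Q"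
  then have q: "fst q \<in> {0..T}" "snd q \<in> space M" by (auto simp: space_Q)
  have "isCont (F (fst q)) (\<xi> u (fst q) (snd q))"
    using F_continuous[OF q(1)] by (simp add: continuous_on_eq_continuous_at)
  then show "(\<lambda>n. running_cost (s n) q) \<longlonglongrightarrow> running_cost u q"
    by (rule isCont_tendsto_compose) (rule \<xi>_tendsto[OF q(2) s])
qed

text \<open>Strict convexity forces the two states to agree almost everywhere in time and probability, and the
  state determines the control.\<close>

lemma state_cost_midpoint_strict:
  assumes "T > 0" and strict: "\<And>t. t \<in> {0..T} \<Longrightarrow> strictly_convex_on UNIV (F t)"
    and uv: "integrable (time_measure T) u" "integrable (time_measure T) v"
    and fin: "state_cost u < \<infinity>" "state_cost v < \<infinity>"
    and eq: "state_cost u + state_cost v \<le> 2 * state_cost (\<lambda>s. (u s + v s) / 2)"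
  shows "AE s in time_measure T. u s = v s"
proof (rule AE_eq_of_\<xi>_eq[OF \<open>T > 0\<close> uv])
  have "AE q in Q. (running_cost u q + running_cost v q) / 2 \<le> running_cost (\<lambda>s. (u s + v s) / 2) q"
    using fin eq uv unfolding state_cost_def
    by (intro nn_integral_midpoint_strict running_cost_measurable running_cost_nonneg running_cost_midpoint) auto
  moreover have "AE q in Q. q \<in> space Q" by (rule AE_space)
  ultimately show "AE q in Q. \<xi> u (fst q) (snd q) = \<xi> v (fst q) (snd q)"
  proof eventually_elim
    case (elim q)
    then have q: "fst q \<in> {0..T}" "snd q \<in> space M" by (auto simp: space_Q)
    let ?x = "\<xi> u (fst q) (snd q)" and ?y = "\<xi> v (fst q) (snd q)"
    show ?case
    proof (rule ccontr)
      assume "?x \<noteq> ?y"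
      then have "F (fst q) ((?x + ?y) / 2) < (F (fst q) ?x + F (fst q) ?y) / 2"
        by (intro strictly_convex_on_midpoint[OF strict[OF q(1)]]) auto
      then show False using elim(1) by (simp add: \<xi>_midpoint[OF q(2) uv])
    qed
  qed
qed

end

section \<open>Minimisers of the penalised cost\<close>

context convex_state_cost
begin

text \<open>The objective; its first term is a single integral over the product of time and probability space,
  so that Fatou's lemma and strict convexity are applied only once to it.\<close>

definition penalized :: "real \<Rightarrow> (real \<Rightarrow> real) \<Rightarrow> (real \<Rightarrow> real) \<Rightarrow> ennreal" where
  "penalized \<delta> \<Psi> u = state_cost u + ennreal \<delta> * (\<integral>\<^sup>+t. ennreal (\<Psi> \<bar>u t\<bar>) \<partial>time_measure T)"

context
  fixes \<Psi> :: "real \<Rightarrow> real" and \<delta> :: real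
  assumes young: "young_function \<Psi>" and \<delta>: "\<delta> > 0"
begin

lemma young_abs_measurable: "(\<lambda>x. \<Psi> \<bar>x\<bar>) \<in> borel_measurable borel"
  by (rule borel_measurable_continuous_onI[OF young_function_abs_continuous[OF young]])

lemma young_compose_measurable:
  "integrable (time_measure T) u \<Longrightarrow> (\<lambda>t. \<Psi> \<bar>u t\<bar>) \<in> borel_measurable (time_measure T)"
  using measurable_compose[OF borel_measurable_integrable young_abs_measurable] .

abbreviation young_int :: "(real \<Rightarrow> real) \<Rightarrow> ennreal" where
  "young_int u \<equiv> \<integral>\<^sup>+t. ennreal (\<Psi> \<bar>u t\<bar>) \<partial>time_measure T"

lemma young_int_midpoint:
  assumes "integrable (time_measure T) u" "integrable (time_measure T) v"
  shows "2 * young_int (\<lambda>s. (u s + v s) / 2) \<le> young_int u + young_int v"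
  using assms young_function_abs_midpoint[OF young] young_function_abs_nonneg[OF young]
  by (intro nn_integral_midpoint young_compose_measurable) auto

lemma penalized_midpoint:
  assumes "integrable (time_measure T) u" "integrable (time_measure T) v"
  shows "2 * penalized \<delta> \<Psi> (\<lambda>s. (u s + v s) / 2) \<le> penalized \<delta> \<Psi> u + penalized \<delta> \<Psi> v"
proof -
  let ?w = "\<lambda>s. (u s + v s) / 2"
  have "2 * penalized \<delta> \<Psi> ?w = 2 * state_cost ?w + ennreal \<delta> * (2 * young_int ?w)"
    by (simp add: penalized_def distrib_left mult.left_commute)
  also have "\<dots> \<le> (state_cost u + state_cost v) + ennreal \<delta> * (young_int u + young_int v)"
    using assms by (intro add_mono mult_left_mono state_cost_midpoint young_int_midpoint) auto
  also have "\<dots> = penalized \<delta> \<Psi> u + penalized \<delta> \<Psi> v" by (simp add: penalized_def distrib_left ac_simps)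
  finally show ?thesis .
qed

theorem exists_penalized_minimizer:
  assumes u0: "integrable (time_measure T) u0" "penalized \<delta> \<Psi> u0 < \<infinity>"
  shows "\<exists>u. integrable (time_measure T) u \<and> penalized \<delta> \<Psi> u < \<infinity> \<and>
     (\<forall>v. integrable (time_measure T) v \<longrightarrow> penalized \<delta> \<Psi> u \<le> penalized \<delta> \<Psi> v)"
proof (rule time.exists_L1_minimizer[where J = "penalized \<delta> \<Psi>" and \<Theta> = "\<lambda>x. \<Psi> \<bar>x\<bar>" and \<delta> = \<delta> and ?u0.0 = u0])
  fix u v :: "real \<Rightarrow> real" assume "integrable (time_measure T) u" "integrable (time_measure T) v"
  then show "penalized \<delta> \<Psi> (\<lambda>x. (u x + v x) / 2) \<le> max (penalized \<delta> \<Psi> u) (penalized \<delta> \<Psi> v)"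
    by (intro ennreal_le_max_of_double_le_add penalized_midpoint)
next
  fix s :: "nat \<Rightarrow> real \<Rightarrow> real" and u c
  assume s: "\<And>n. integrable (time_measure T) (s n)" and u: "integrable (time_measure T) u"
    and lim: "AE x in time_measure T. (\<lambda>n. s n x) \<longlonglongrightarrow> u x"
    and L1: "(\<lambda>n. \<integral>x. \<bar>s n x - u x\<bar> \<partial>time_measure T) \<longlonglongrightarrow> 0"
    and le: "\<And>n. penalized \<delta> \<Psi> (s n) \<le> c"
  have "young_int u \<le> liminf (\<lambda>n. young_int (s n))"
  proof (rule nn_integral_le_of_AE_tendsto)
    show "AE x in time_measure T. (\<lambda>n. \<Psi> \<bar>s n x\<bar>) \<longlonglongrightarrow> \<Psi> \<bar>u x\<bar>"
      using lim
    proof eventually_elim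
      case (elim x)
      show ?case
        by (rule isCont_tendsto_compose[OF _ elim, where g = "\<lambda>x. \<Psi> \<bar>x\<bar>"])
          (use young_function_abs_continuous[OF young] in \<open>simp add: continuous_on_eq_continuous_at\<close>)
    qed
  qed (intro young_compose_measurable s)
  then have "ennreal \<delta> * young_int u \<le> ennreal \<delta> * liminf (\<lambda>n. young_int (s n))" by (rule mult_left_mono) simp
  also have "\<dots> \<le> liminf (\<lambda>n. ennreal \<delta> * young_int (s n))"
    unfolding liminf_SUP_INF SUP_mult_left_ennreal
    by (intro SUP_mono' INF_greatest mult_left_mono INF_lower) auto
  finally have "penalized \<delta> \<Psi> u \<le> liminf (\<lambda>n. state_cost (s n)) + liminf (\<lambda>n. ennreal \<delta> * young_int (s n))"
    unfolding penalized_def by (intro add_mono state_cost_lower_semicontinuous s u L1)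
  also have "\<dots> \<le> liminf (\<lambda>n. penalized \<delta> \<Psi> (s n))"
    unfolding penalized_def by (rule liminf_add_le_ennreal)
  also have "\<dots> \<le> c" using le by (intro Liminf_le) auto
  finally show "penalized \<delta> \<Psi> u \<le> c" .
next
  show "\<exists>R. \<forall>t. R \<le> \<bar>t\<bar> \<longrightarrow> K * \<bar>t\<bar> \<le> \<Psi> \<bar>t\<bar>" for K
    by (rule young_function_superlinear[OF young])
  show "0 \<le> \<Psi> \<bar>t\<bar>" for t by (rule young_function_abs_nonneg[OF young])
  show "ennreal \<delta> * young_int u \<le> penalized \<delta> \<Psi> u" for u by (simp add: penalized_def)
qed (fact young_abs_measurable \<delta> u0)+

text \<open>The midpoint of the two minimisers has at least the minimal value, so the midpoint inequalities for
  the cost and for the penalty are both equalities, and the strictly convex one of them identifies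
  the controls.\<close>

theorem penalized_minimizer_unique:
  assumes "T > 0"
    and strict: "(\<forall>t\<in>{0..T}. strictly_convex_on UNIV (F t)) \<or> strictly_convex_on {0..} \<Psi>"
    and u: "integrable (time_measure T) u" and v: "integrable (time_measure T) v"
    and fin: "penalized \<delta> \<Psi> u < \<infinity>" and eq: "penalized \<delta> \<Psi> v = penalized \<delta> \<Psi> u"
    and min: "\<And>w. integrable (time_measure T) w \<Longrightarrow> penalized \<delta> \<Psi> u \<le> penalized \<delta> \<Psi> w"
  shows "AE t in time_measure T. v t = u t"
proof -
  let ?w = "\<lambda>s. (v s + u s) / 2"
  have w: "integrable (time_measure T) ?w" using u v by simp
  have fin_v: "penalized \<delta> \<Psi> v < \<infinity>" using fin eq by simp
  have fin_parts: "state_cost u < \<infinity>" "state_cost v < \<infinity>" "ennreal \<delta> * young_int u < \<infinity>" "ennreal \<delta> * young_int v < \<infinity>"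
    using fin fin_v unfolding penalized_def by auto
  have "(state_cost v + state_cost u) + ennreal \<delta> * (young_int v + young_int u) = 2 * penalized \<delta> \<Psi> u"
    using eq unfolding mult_2 by (subst (2) eq[symmetric]) (simp add: penalized_def distrib_left ac_simps)
  also have "\<dots> \<le> 2 * penalized \<delta> \<Psi> ?w" using min[OF w] by (rule mult_left_mono) simp
  also have "\<dots> = 2 * state_cost ?w + ennreal \<delta> * (2 * young_int ?w)"
    by (simp add: penalized_def distrib_left mult.left_commute)
  finally have sum: "(state_cost v + state_cost u) + ennreal \<delta> * (young_int v + young_int u)
     \<le> 2 * state_cost ?w + ennreal \<delta> * (2 * young_int ?w)" .
  have le: "2 * state_cost ?w \<le> state_cost v + state_cost u"
    "ennreal \<delta> * (2 * young_int ?w) \<le> ennreal \<delta> * (young_int v + young_int u)"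
    by (rule state_cost_midpoint[OF v u], rule mult_left_mono[OF young_int_midpoint[OF v u]]) simp
  have fin': "state_cost v + state_cost u < \<infinity>" "ennreal \<delta> * (young_int v + young_int u) < \<infinity>"
    using fin_parts by (auto simp: distrib_left)
  note eqs = ennreal_sum_squeeze[OF le sum fin']
  from strict show ?thesis
  proof
    assume "\<forall>t\<in>{0..T}. strictly_convex_on UNIV (F t)"
    then show ?thesis
      using eqs(1) fin_parts u v \<open>T > 0\<close> by (intro state_cost_midpoint_strict) auto
  next
    assume sc: "strictly_convex_on {0..} \<Psi>"
    have "young_int v + young_int u \<le> 2 * young_int ?w"
      using eqs(2) \<delta> by (simp add: ennreal_mult_le_mult_iff)
    moreover have "young_int u < \<infinity>" "young_int v < \<infinity>"
      using fin_parts \<delta> by (auto simp: ennreal_mult_less_top)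
    ultimately have "AE t in time_measure T. (\<Psi> \<bar>v t\<bar> + \<Psi> \<bar>u t\<bar>) / 2 \<le> \<Psi> \<bar>?w t\<bar>"
      using nn_integral_midpoint_strict[OF young_compose_measurable[OF v] young_compose_measurable[OF u] young_compose_measurable[OF w]
          young_function_abs_nonneg[OF young] young_function_abs_nonneg[OF young]
          young_function_abs_nonneg[OF young] young_function_abs_midpoint[OF young]]
      by blast
    then show ?thesis
    proof eventually_elim
      case (elim t)
      then show ?case
        using young_function_abs_midpoint_strict[OF young sc, of "v t" "u t"] by force
    qed
  qed
qed

end

end

section \<open>Moments of the uncontrolled state\<close>

lemma powr_le_one_add_powr:
  fixes x a b :: real
  assumes "x \<ge> 0" "0 \<le> a" "a \<le> b"
  shows "x powr a \<le> 1 + x powr b"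
proof (cases "x \<le> 1")
  case True
  then have "x powr a \<le> 1" using assms by (intro powr_le1) auto
  then show ?thesis by (simp add: add_increasing2)
next
  case False
  then have "x powr a \<le> x powr b" using assms by (intro powr_mono) auto
  then show ?thesis by simp
qed

text \<open>The graph of \<open>y \<mapsto> y\<^sup>\<beta>\<close> lies above its tangent at \<open>m\<close>; this is Young's inequality for \<open>y\<close> and
  \<open>m\<^sup>\<beta>\<^sup>-\<^sup>1\<close>.\<close>

lemma powr_tangent_le:
  fixes \<beta> m y :: real
  assumes "\<beta> \<ge> 1" "m > 0" "y \<ge> 0"
  shows "\<beta> * m powr (\<beta> - 1) * y \<le> y powr \<beta> + (\<beta> - 1) * m powr \<beta>"
proof (cases "\<beta> = 1")
  case True then show ?thesis using assms by simp
next
  case False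
  then have \<beta>: "\<beta> > 1" using assms by simp
  have "y * m powr (\<beta> - 1) \<le> y powr \<beta> / \<beta> + (m powr (\<beta> - 1)) powr (\<beta> / (\<beta> - 1)) / (\<beta> / (\<beta> - 1))"
    using \<beta> assms by (intro Youngs_inequality) (auto simp: field_simps)
  also have "(m powr (\<beta> - 1)) powr (\<beta> / (\<beta> - 1)) = m powr \<beta>"
    using \<beta> by (simp add: powr_powr)
  finally have "\<beta> * (y * m powr (\<beta> - 1)) \<le> \<beta> * (y powr \<beta> / \<beta> + m powr \<beta> / (\<beta> / (\<beta> - 1)))"
    using \<beta> by (intro mult_left_mono) auto
  also have "\<dots> = y powr \<beta> + (\<beta> - 1) * m powr \<beta>" using \<beta> by (simp add: distrib_left)
  finally show ?thesis by (simp add: ac_simps)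
qed

text \<open>Jensen's inequality for the probability density \<open>w / V\<close>, where \<open>V\<close> is the integral of \<open>w\<close>: integrate the tangent
  inequality at the mean \<open>m\<close>. The right-hand side is kept as an integral with values in
  \<open>[0, \<infinity>]\<close>, so that Fubini's theorem applies to it directly.\<close>

lemma weighted_jensen_powr:
  fixes w y :: "'b \<Rightarrow> real"
  assumes w: "integrable N w" "\<And>x. x \<in> space N \<Longrightarrow> w x \<ge> 0"
    and y: "integrable N (\<lambda>x. w x * y x)" "\<And>x. x \<in> space N \<Longrightarrow> y x \<ge> 0"
    and [measurable]: "y \<in> borel_measurable N" and V: "(\<integral>x. w x \<partial>N) > 0" and "\<beta> \<ge> 1"
  shows "ennreal ((\<integral>x. w x * y x \<partial>N) powr \<beta>)
     \<le> ennreal ((\<integral>x. w x \<partial>N) powr (\<beta> - 1)) * (\<integral>\<^sup>+x. ennreal (w x * y x powr \<beta>) \<partial>N)"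
proof -
  define V where "V = (\<integral>x. w x \<partial>N)"
  define I where "I = (\<integral>x. w x * y x \<partial>N)"
  have V0: "V > 0" using V by (simp add: V_def)
  have [measurable]: "w \<in> borel_measurable N" using w by auto
  have I0: "I \<ge> 0" unfolding I_def using w y by (intro integral_nonneg_AE AE_I2) auto
  show ?thesis
  proof (cases "I = 0 \<or> (\<integral>\<^sup>+x. ennreal (w x * y x powr \<beta>) \<partial>N) = top")
    case True
    then show ?thesis using V0 by (auto simp: V_def[symmetric] I_def[symmetric] ennreal_mult_top)
  next
    case False
    then have I: "I > 0" and fin: "(\<integral>\<^sup>+x. ennreal (w x * y x powr \<beta>) \<partial>N) < top"
      using I0 by (auto simp: less_top)
    define m where "m = I / V"
    have m: "m > 0" "I = m * V" using I V0 by (auto simp: m_def)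
    have wy: "integrable N (\<lambda>x. w x * y x powr \<beta>)"
    proof (rule integrableI_bounded)
      have "(\<integral>\<^sup>+x. ennreal (norm (w x * y x powr \<beta>)) \<partial>N) = (\<integral>\<^sup>+x. ennreal (w x * y x powr \<beta>) \<partial>N)"
        using w by (intro nn_integral_cong) auto
      then show "(\<integral>\<^sup>+x. ennreal (norm (w x * y x powr \<beta>)) \<partial>N) < \<infinity>" using fin by simp
    qed measurable
    have "(\<integral>x. \<beta> * m powr (\<beta> - 1) * (w x * y x) \<partial>N) \<le> (\<integral>x. w x * y x powr \<beta> + (\<beta> - 1) * m powr \<beta> * w x \<partial>N)"
    proof (rule integral_mono)
      fix x assume x: "x \<in> space N"
      have "w x * (\<beta> * m powr (\<beta> - 1) * y x) \<le> w x * (y x powr \<beta> + (\<beta> - 1) * m powr \<beta>)"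
        using w(2)[OF x] y(2)[OF x] m \<open>\<beta> \<ge> 1\<close> by (intro mult_left_mono powr_tangent_le) auto
      then show "\<beta> * m powr (\<beta> - 1) * (w x * y x) \<le> w x * y x powr \<beta> + (\<beta> - 1) * m powr \<beta> * w x"
        by (simp add: algebra_simps)
    qed (use w y wy in auto)
    then have "\<beta> * m powr (\<beta> - 1) * I \<le> (\<integral>x. w x * y x powr \<beta> \<partial>N) + (\<beta> - 1) * m powr \<beta> * V"
      using wy w by (simp add: I_def V_def)
    moreover have "\<beta> * m powr (\<beta> - 1) * I = \<beta> * (m powr \<beta> * V)"
      using m by (simp add: powr_diff)
    moreover have "(\<beta> - 1) * m powr \<beta> * V = \<beta> * (m powr \<beta> * V) - m powr \<beta> * V" by algebra
    ultimately have le: "m powr \<beta> * V \<le> (\<integral>x. w x * y x powr \<beta> \<partial>N)"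
      by linarith
    have "I powr \<beta> = V powr (\<beta> - 1) * (m powr \<beta> * V)"
      using m V0 by (simp add: powr_mult powr_diff)
    also have "\<dots> \<le> V powr (\<beta> - 1) * (\<integral>x. w x * y x powr \<beta> \<partial>N)"
      using le by (intro mult_left_mono) auto
    finally have "ennreal (I powr \<beta>) \<le> ennreal (V powr (\<beta> - 1)) * ennreal (\<integral>x. w x * y x powr \<beta> \<partial>N)"
      by (simp add: ennreal_leI flip: ennreal_mult')
    also have "ennreal (\<integral>x. w x * y x powr \<beta> \<partial>N) = (\<integral>\<^sup>+x. ennreal (w x * y x powr \<beta>) \<partial>N)"
      using wy w by (intro nn_integral_eq_integral[symmetric]) auto
    finally show ?thesis by (simp add: I_def V_def)
  qed
qed

text \<open>Whichever factor dominates, after comparison of \<open>R\<close> with \<open>\<zeta>\<close> raised to \<open>(p - \<beta>) / \<beta>\<close>, the product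
  is bounded by a power of it. The exponent on \<open>\<zeta>\<close> is the one for which moments are available; the
  one on \<open>R\<close> is large, but the noise has moments of all orders.\<close>

lemma mult_powr_le_add:
  fixes R \<zeta> \<beta> p :: real
  assumes "R \<ge> 0" "\<zeta> \<ge> 0" "0 < \<beta>" "\<beta> < p"
  shows "(R * \<zeta>) powr \<beta> \<le> \<zeta> powr p + R powr (\<beta> * p / (p - \<beta>))"
proof (cases "R = 0 \<or> \<zeta> = 0")
  case True then show ?thesis by auto
next
  case False
  then have R: "R > 0" and \<zeta>: "\<zeta> > 0" using assms by auto
  show ?thesis
  proof (cases "R \<le> \<zeta> powr ((p - \<beta>) / \<beta>)")
    case True
    then have "(R * \<zeta>) powr \<beta> \<le> (\<zeta> powr ((p - \<beta>) / \<beta>) * \<zeta>) powr \<beta>"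
      using R \<zeta> assms by (intro powr_mono2 mult_right_mono) auto
    also have "\<zeta> powr ((p - \<beta>) / \<beta>) * \<zeta> = \<zeta> powr ((p - \<beta>) / \<beta> + 1)" using \<zeta> by (simp add: powr_add)
    also have "(p - \<beta>) / \<beta> + 1 = p / \<beta>" using assms by (simp add: field_simps)
    also have "(\<zeta> powr (p / \<beta>)) powr \<beta> = \<zeta> powr p" using assms by (simp add: powr_powr)
    finally show ?thesis by (simp add: add_increasing2)
  next
    case False
    then have "(\<zeta> powr ((p - \<beta>) / \<beta>)) powr (\<beta> / (p - \<beta>)) \<le> R powr (\<beta> / (p - \<beta>))"
      using assms by (intro powr_mono2) auto
    then have "\<zeta> \<le> R powr (\<beta> / (p - \<beta>))" using assms \<zeta> by (simp add: powr_powr)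
    then have "(R * \<zeta>) powr \<beta> \<le> (R * R powr (\<beta> / (p - \<beta>))) powr \<beta>"
      using R \<zeta> assms by (intro powr_mono2 mult_left_mono) auto
    also have "R * R powr (\<beta> / (p - \<beta>)) = R powr (1 + \<beta> / (p - \<beta>))" using R by (simp add: powr_add)
    also have "1 + \<beta> / (p - \<beta>) = p / (p - \<beta>)" using assms by (simp add: field_simps)
    also have "(R powr (p / (p - \<beta>))) powr \<beta> = R powr (\<beta> * p / (p - \<beta>))" by (simp add: powr_powr mult.commute)
    finally show ?thesis by (simp add: add_increasing)
  qed
qed

context linear_state
begin

text \<open>The weight \<open>w\<close> majorises the \<open>L\<^sup>p\<close> norms of \<open>Z\<close>. Write the Volterra integral as the integral of
  \<open>w y\<close>, where \<open>y\<close> is the product of the ratio \<open>H t / H s\<close> with the normalised process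
  \<open>\<bar>Z s\<bar> / w s\<close>, whose \<open>p\<close>-th moment is at most one. Jensen's inequality
  with weight \<open>w\<close>, Fubini's theorem and the splitting of the product \<open>y\<^sup>\<beta>\<close> reduce the claim to moments
  of the two factors.\<close>

lemma \<xi>_zero_moment_bound:
  fixes w :: "real \<Rightarrow> real"
  assumes "T > 0" "1 \<le> \<beta>" "\<beta> < p"
    and w: "integrable (time_measure T) w" "\<And>t. t \<in> {0..T} \<Longrightarrow> w t \<ge> 1"
    and Zp: "\<And>t. t \<in> {0..T} \<Longrightarrow> (\<integral>\<^sup>+\<omega>. ennreal (\<bar>Z t \<omega>\<bar> powr p) \<partial>M) \<le> ennreal (w t powr p)"
    and Hq: "\<And>s t. 0 \<le> s \<Longrightarrow> s \<le> t \<Longrightarrow> t \<le> T \<Longrightarrow>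
        (\<integral>\<^sup>+\<omega>. ennreal ((H t \<omega> / H s \<omega>) powr (\<beta> * p / (p - \<beta>))) \<partial>M) \<le> ennreal C"
    and "C \<ge> 0" and t: "t \<in> {0..T}"
  shows "(\<integral>\<^sup>+\<omega>. ennreal (\<bar>\<xi> (\<lambda>_. 0) t \<omega>\<bar> powr \<beta>) \<partial>M)
     \<le> ennreal ((\<integral>s. w s \<partial>time_measure T) powr \<beta> * (1 + C))"
proof -
  define V where "V = (\<integral>s. w s \<partial>time_measure T)"
  have [measurable]: "w \<in> borel_measurable (time_measure T)" using w by auto
  have V: "V > 0"
  proof -
    have "(\<integral>s. 1 \<partial>time_measure T) \<le> V"
      unfolding V_def using w by (intro integral_mono) (auto simp: space_time_measure)
    moreover have "measure (time_measure T) (space (time_measure T)) = T"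
      using \<open>T > 0\<close> by (simp add: space_time_measure measure_restrict_space)
    ultimately show ?thesis using \<open>T > 0\<close> by simp
  qed
  have id [measurable]: "(\<lambda>x. x) \<in> time_measure T \<rightarrow>\<^sub>M borel" by (rule measurable_restrict_space1) simp
  define y where "y \<omega> s = indicator {0..t} s * (H t \<omega> / H s \<omega>) * (\<bar>Z s \<omega>\<bar> / w s)" for \<omega> s
  note [measurable] = H_measurable Z_measurable
  have Ht [measurable]: "H t \<in> borel_measurable M"
    using measurable_Pair2[OF H_measurable, of t] t by (simp add: space_time_measure)
  have y_pair [measurable]: "(\<lambda>(s, \<omega>). y \<omega> s) \<in> borel_measurable (time_measure T \<Otimes>\<^sub>M M)"
  proof -
    have fst_m [measurable]: "(\<lambda>q. fst q) \<in> borel_measurable (time_measure T \<Otimes>\<^sub>M M)"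
      by (rule measurable_compose[OF measurable_fst id])
    have [measurable]: "(\<lambda>q. H (fst q) (snd q)) \<in> borel_measurable (time_measure T \<Otimes>\<^sub>M M)"
       "(\<lambda>q. Z (fst q) (snd q)) \<in> borel_measurable (time_measure T \<Otimes>\<^sub>M M)"
      using H_measurable Z_measurable by (simp_all add: split_def)
    have [measurable]: "(\<lambda>q. H t (snd q)) \<in> borel_measurable (time_measure T \<Otimes>\<^sub>M M)"
      by (rule measurable_compose[OF measurable_snd Ht])
    have [measurable]: "(\<lambda>q. w (fst q)) \<in> borel_measurable (time_measure T \<Otimes>\<^sub>M M)"
      by measurable
    show ?thesis unfolding y_def split_def indicator_def atLeastAtMost_iff by measurable
  qed
  have y_sec [measurable]: "y \<omega> \<in> borel_measurable (time_measure T)" if "\<omega> \<in> space M" for \<omega>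
    using measurable_Pair1[OF y_pair that] by simp
  have y_nonneg: "y \<omega> s \<ge> 0" if "s \<in> {0..T}" "\<omega> \<in> space M" for s \<omega>
    unfolding y_def using H_pos[OF t that(2)] H_pos[OF that] w(2)[OF that(1)]
    by (intro mult_nonneg_nonneg divide_nonneg_nonneg) auto
  have wy: "w s * y \<omega> s = H t \<omega> * (indicator {0..t} s / H s \<omega> * \<bar>Z s \<omega>\<bar>)" if "s \<in> {0..T}" for s \<omega>
    using w(2)[OF that] by (simp add: y_def)
  have wy_int: "integrable (time_measure T) (\<lambda>s. w s * y \<omega> s)" if "\<omega> \<in> space M" for \<omega>
  proof -
    have "integrable (time_measure T) (\<lambda>s. H t \<omega> * (indicator {0..t} s / H s \<omega> * \<bar>Z s \<omega>\<bar>))"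
      by (intro integrable_mult_right kernel_integrable[OF that] integrable_abs Z_integrable[OF that])
    then show ?thesis
      by (subst Bochner_Integration.integrable_cong[OF refl wy]) (auto simp: space_time_measure)
  qed
  have "(\<integral>\<^sup>+\<omega>. ennreal (\<bar>\<xi> (\<lambda>_. 0) t \<omega>\<bar> powr \<beta>) \<partial>M)
     \<le> (\<integral>\<^sup>+\<omega>. ennreal (V powr (\<beta> - 1)) * (\<integral>\<^sup>+s. ennreal (w s * y \<omega> s powr \<beta>) \<partial>time_measure T) \<partial>M)"
  proof (rule nn_integral_mono)
    fix \<omega> assume \<omega>: "\<omega> \<in> space M"
    have "\<bar>\<integral>s. indicator {0..t} s / H s \<omega> * (Z s \<omega> - 0) \<partial>time_measure T\<bar>
       \<le> (\<integral>s. \<bar>indicator {0..t} s / H s \<omega> * (Z s \<omega> - 0)\<bar> \<partial>time_measure T)"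
      by (rule integral_abs_bound)
    also have "\<dots> = (\<integral>s. indicator {0..t} s / H s \<omega> * \<bar>Z s \<omega>\<bar> \<partial>time_measure T)"
    proof (intro Bochner_Integration.integral_cong refl)
      fix s assume "s \<in> space (time_measure T)"
      then have "\<bar>H s \<omega>\<bar> = H s \<omega>" using H_pos[OF _ \<omega>, of s] by (simp add: space_time_measure)
      then show "\<bar>indicator {0..t} s / H s \<omega> * (Z s \<omega> - 0)\<bar> = indicator {0..t} s / H s \<omega> * \<bar>Z s \<omega>\<bar>"
        by (simp add: abs_mult)
    qed
    finally have "\<bar>\<xi> (\<lambda>_. 0) t \<omega>\<bar> \<le> H t \<omega> * (\<integral>s. indicator {0..t} s / H s \<omega> * \<bar>Z s \<omega>\<bar> \<partial>time_measure T)"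
      unfolding \<xi>_def using H_pos[OF t \<omega>] by (simp add: abs_mult)
    also have "\<dots> = (\<integral>s. w s * y \<omega> s \<partial>time_measure T)"
      unfolding integral_mult_right_zero[symmetric]
      using wy by (intro Bochner_Integration.integral_cong) (auto simp: space_time_measure)
    finally have "ennreal (\<bar>\<xi> (\<lambda>_. 0) t \<omega>\<bar> powr \<beta>) \<le> ennreal ((\<integral>s. w s * y \<omega> s \<partial>time_measure T) powr \<beta>)"
      using \<open>1 \<le> \<beta>\<close> by (intro ennreal_leI powr_mono2) auto
    also have "\<dots> \<le> ennreal (V powr (\<beta> - 1)) * (\<integral>\<^sup>+s. ennreal (w s * y \<omega> s powr \<beta>) \<partial>time_measure T)"
      unfolding V_def using w V y_nonneg[OF _ \<omega>] wy_int[OF \<omega>] y_sec[OF \<omega>] \<open>1 \<le> \<beta>\<close>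
      by (intro weighted_jensen_powr) (auto simp: space_time_measure V_def intro: order_trans[of 0 1])
    finally show "ennreal (\<bar>\<xi> (\<lambda>_. 0) t \<omega>\<bar> powr \<beta>)
      \<le> ennreal (V powr (\<beta> - 1)) * (\<integral>\<^sup>+s. ennreal (w s * y \<omega> s powr \<beta>) \<partial>time_measure T)" .
  qed
  also have "\<dots> = ennreal (V powr (\<beta> - 1)) * (\<integral>\<^sup>+\<omega>. (\<integral>\<^sup>+s. ennreal (w s * y \<omega> s powr \<beta>) \<partial>time_measure T) \<partial>M)"
    by (intro nn_integral_cmult) measurable
  also have "(\<integral>\<^sup>+\<omega>. (\<integral>\<^sup>+s. ennreal (w s * y \<omega> s powr \<beta>) \<partial>time_measure T) \<partial>M)
      = (\<integral>\<^sup>+s. (\<integral>\<^sup>+\<omega>. ennreal (w s * y \<omega> s powr \<beta>) \<partial>M) \<partial>time_measure T)"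
    by (rule pair.Fubini'[where f = "\<lambda>s \<omega>. ennreal (w s * y \<omega> s powr \<beta>)"]) measurable
  also have "\<dots> \<le> (\<integral>\<^sup>+s. ennreal ((1 + C) * w s) \<partial>time_measure T)"
  proof (rule nn_integral_mono)
    fix s assume "s \<in> space (time_measure T)"
    then have s: "s \<in> {0..T}" by (simp add: space_time_measure)
    have ws: "w s \<ge> 1" by (rule w(2)[OF s])
    have Hs [measurable]: "H s \<in> borel_measurable M" and Zs [measurable]: "Z s \<in> borel_measurable M"
      using measurable_Pair2[OF H_measurable, of s] measurable_Pair2[OF Z_measurable, of s] s
      by (simp_all add: space_time_measure)
    show "(\<integral>\<^sup>+\<omega>. ennreal (w s * y \<omega> s powr \<beta>) \<partial>M) \<le> ennreal ((1 + C) * w s)"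
    proof (cases "s \<le> t")
      case False
      then have "y \<omega> s = 0" for \<omega> by (simp add: y_def)
      then show ?thesis by simp
    next
      case True
      let ?q = "\<beta> * p / (p - \<beta>)"
      have "(\<integral>\<^sup>+\<omega>. ennreal (w s * y \<omega> s powr \<beta>) \<partial>M)
        \<le> (\<integral>\<^sup>+\<omega>. ennreal (w s) * (ennreal (1 / w s powr p) * ennreal (\<bar>Z s \<omega>\<bar> powr p) + ennreal ((H t \<omega> / H s \<omega>) powr ?q)) \<partial>M)"
      proof (rule nn_integral_mono)
        fix \<omega> assume \<omega>: "\<omega> \<in> space M"
        have "y \<omega> s powr \<beta> = ((H t \<omega> / H s \<omega>) * (\<bar>Z s \<omega>\<bar> / w s)) powr \<beta>"
          using True s by (simp add: y_def)
        also have "\<dots> \<le> (\<bar>Z s \<omega>\<bar> / w s) powr p + (H t \<omega> / H s \<omega>) powr ?q"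
          using H_pos[OF t \<omega>] H_pos[OF s \<omega>] ws assms(2,3) by (intro mult_powr_le_add) auto
        also have "(\<bar>Z s \<omega>\<bar> / w s) powr p = 1 / w s powr p * \<bar>Z s \<omega>\<bar> powr p"
          using ws by (simp add: powr_divide)
        finally have "w s * y \<omega> s powr \<beta> \<le> w s * (1 / w s powr p * \<bar>Z s \<omega>\<bar> powr p + (H t \<omega> / H s \<omega>) powr ?q)"
          using ws by (intro mult_left_mono) auto
        then have "ennreal (w s * y \<omega> s powr \<beta>) \<le> ennreal (w s * (1 / w s powr p * \<bar>Z s \<omega>\<bar> powr p + (H t \<omega> / H s \<omega>) powr ?q))"
          by (rule ennreal_leI)
        also have "\<dots> = ennreal (w s) * (ennreal (1 / w s powr p) * ennreal (\<bar>Z s \<omega>\<bar> powr p) + ennreal ((H t \<omega> / H s \<omega>) powr ?q))"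
          using ws by (simp add: ennreal_mult ennreal_plus del: times_divide_eq_left)
        finally show "ennreal (w s * y \<omega> s powr \<beta>) \<le> \<dots>" .
      qed
      also have "\<dots> = ennreal (w s) * (ennreal (1 / w s powr p) * (\<integral>\<^sup>+\<omega>. ennreal (\<bar>Z s \<omega>\<bar> powr p) \<partial>M)
          + (\<integral>\<^sup>+\<omega>. ennreal ((H t \<omega> / H s \<omega>) powr ?q) \<partial>M))"
        by (simp add: nn_integral_cmult nn_integral_add)
      also have "\<dots> \<le> ennreal (w s) * (ennreal (1 / w s powr p) * ennreal (w s powr p) + ennreal C)"
        using Zp[OF s] Hq[of s t] s t True by (intro mult_left_mono add_mono) auto
      also have "\<dots> = ennreal ((1 + C) * w s)"
        using ws \<open>C \<ge> 0\<close> by (simp flip: ennreal_mult ennreal_plus ennreal_1 add: mult.commute)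
      finally show ?thesis .
    qed
  qed
  also have "(\<integral>\<^sup>+s. ennreal ((1 + C) * w s) \<partial>time_measure T) = ennreal ((1 + C) * V)"
    using w \<open>C \<ge> 0\<close> unfolding V_def
    by (subst nn_integral_eq_integral) (auto intro!: AE_I2 mult_nonneg_nonneg intro: order_trans[of 0 1] simp: space_time_measure)
  also have "ennreal (V powr (\<beta> - 1)) * ennreal ((1 + C) * V) = ennreal (V powr \<beta> * (1 + C))"
    using V \<open>C \<ge> 0\<close> by (simp add: powr_diff flip: ennreal_mult')
  finally show ?thesis by (simp add: V_def mult_left_mono)
qed

end

context convex_state_cost
begin

text \<open>The growth exponent \<open>\<alpha>\<close> may be below one, where Jensen's inequality fails; it is replaced by
  \<open>max \<alpha> 1\<close>, which is still smaller than \<open>p\<close>.\<close>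

lemma state_cost_zero_finite:
  fixes w L :: "real \<Rightarrow> real"
  assumes "T > 0" "0 < \<alpha>" "\<alpha> < p" "p > 1"
    and L: "integrable (time_measure T) L" "\<And>t. t \<in> {0..T} \<Longrightarrow> L t \<ge> 0"
    and growth: "\<And>t x. t \<in> {0..T} \<Longrightarrow> F t x \<le> L t * (1 + \<bar>x\<bar> powr \<alpha>)"
    and w: "integrable (time_measure T) w" "\<And>t. t \<in> {0..T} \<Longrightarrow> w t \<ge> 1"
    and Zp: "\<And>t. t \<in> {0..T} \<Longrightarrow> (\<integral>\<^sup>+\<omega>. ennreal (\<bar>Z t \<omega>\<bar> powr p) \<partial>M) \<le> ennreal (w t powr p)"
    and Hq: "\<And>q. \<exists>C. \<forall>s t. 0 \<le> s \<longrightarrow> s \<le> t \<longrightarrow> t \<le> T \<longrightarrow>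
        (\<integral>\<^sup>+\<omega>. ennreal ((H t \<omega> / H s \<omega>) powr q) \<partial>M) \<le> ennreal C"
  shows "state_cost (\<lambda>_. 0) < \<infinity>"
proof -
  define \<beta> where "\<beta> = max \<alpha> 1"
  have \<beta>: "1 \<le> \<beta>" "\<beta> < p" "\<alpha> \<le> \<beta>" using assms by (auto simp: \<beta>_def)
  obtain C' where C': "\<And>s t. 0 \<le> s \<Longrightarrow> s \<le> t \<Longrightarrow> t \<le> T \<Longrightarrow>
        (\<integral>\<^sup>+\<omega>. ennreal ((H t \<omega> / H s \<omega>) powr (\<beta> * p / (p - \<beta>))) \<partial>M) \<le> ennreal C'"
    using Hq by meson
  define C where "C = max 0 C'"
  have C: "C \<ge> 0" "\<And>s t. 0 \<le> s \<Longrightarrow> s \<le> t \<Longrightarrow> t \<le> T \<Longrightarrow>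
        (\<integral>\<^sup>+\<omega>. ennreal ((H t \<omega> / H s \<omega>) powr (\<beta> * p / (p - \<beta>))) \<partial>M) \<le> ennreal C"
    using C' by (auto simp: C_def intro: order_trans[OF _ ennreal_leI])
  define B where "B = (\<integral>s. w s \<partial>time_measure T) powr \<beta> * (1 + C)"
  have B: "B \<ge> 0" using C by (simp add: B_def)
  have moment: "(\<integral>\<^sup>+\<omega>. ennreal (\<bar>\<xi> (\<lambda>_. 0) t \<omega>\<bar> powr \<beta>) \<partial>M) \<le> ennreal B" if "t \<in> {0..T}" for t
    unfolding B_def by (rule \<xi>_zero_moment_bound[OF \<open>T > 0\<close> \<beta>(1,2) w Zp C(2) C(1) that])
  have zero: "integrable (time_measure T) (\<lambda>_. 0 :: real)" by simp
  have "state_cost (\<lambda>_. 0) = (\<integral>\<^sup>+t. (\<integral>\<^sup>+\<omega>. ennreal (F t (\<xi> (\<lambda>_. 0) t \<omega>)) \<partial>M) \<partial>time_measure T)"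
    unfolding state_cost_def using running_cost_measurable[OF zero]
    by (subst nn_integral_fst[symmetric]) auto
  also have "\<dots> \<le> (\<integral>\<^sup>+t. ennreal ((2 + B) * L t) \<partial>time_measure T)"
  proof (rule nn_integral_mono)
    fix t assume "t \<in> space (time_measure T)"
    then have t: "t \<in> {0..T}" by (simp add: space_time_measure)
    have [measurable]: "\<xi> (\<lambda>_. 0) t \<in> borel_measurable M"
      using measurable_Pair2[OF \<xi>_measurable, of "\<lambda>_. 0" t] t by (simp add: space_time_measure)
    have "(\<integral>\<^sup>+\<omega>. ennreal (F t (\<xi> (\<lambda>_. 0) t \<omega>)) \<partial>M)
      \<le> (\<integral>\<^sup>+\<omega>. ennreal (L t) * (2 + ennreal (\<bar>\<xi> (\<lambda>_. 0) t \<omega>\<bar> powr \<beta>)) \<partial>M)"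
    proof (rule nn_integral_mono)
      fix \<omega>
      let ?x = "\<xi> (\<lambda>_. 0) t \<omega>"
      have "F t ?x \<le> L t * (1 + \<bar>?x\<bar> powr \<alpha>)" by (rule growth[OF t])
      also have "\<dots> \<le> L t * (2 + \<bar>?x\<bar> powr \<beta>)"
        using L(2)[OF t] powr_le_one_add_powr[of "\<bar>?x\<bar>" \<alpha> \<beta>] \<beta> \<open>0 < \<alpha>\<close> by (intro mult_left_mono) auto
      finally have "ennreal (F t ?x) \<le> ennreal (L t * (2 + \<bar>?x\<bar> powr \<beta>))" by (rule ennreal_leI)
      also have "\<dots> = ennreal (L t) * (2 + ennreal (\<bar>?x\<bar> powr \<beta>))"
        using L(2)[OF t] by (simp add: ennreal_mult)
      finally show "ennreal (F t ?x) \<le> \<dots>" .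
    qed
    also have "\<dots> = ennreal (L t) * (2 + (\<integral>\<^sup>+\<omega>. ennreal (\<bar>\<xi> (\<lambda>_. 0) t \<omega>\<bar> powr \<beta>) \<partial>M))"
      by (simp add: nn_integral_cmult nn_integral_add emeasure_space_1)
    also have "\<dots> \<le> ennreal (L t) * (2 + ennreal B)"
      by (intro mult_left_mono add_left_mono moment[OF t]) simp
    also have "\<dots> = ennreal ((2 + B) * L t)"
      using L(2)[OF t] B by (simp add: ennreal_mult mult.commute)
    finally show "(\<integral>\<^sup>+\<omega>. ennreal (F t (\<xi> (\<lambda>_. 0) t \<omega>)) \<partial>M) \<le> ennreal ((2 + B) * L t)" .
  qed
  also have "\<dots> < \<infinity>"
    using L B by (subst nn_integral_eq_integral) (auto intro!: AE_I2 simp: space_time_measure)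
  finally show ?thesis .
qed

end

section \<open>Brownian motion and integrable paths\<close>

text \<open>The Gaussian moment generating function, by completing the square: the integrand is a multiple of
  the normal density with mean \<open>q \<sigma>\<^sup>2\<close>.\<close>

lemma nn_integral_exp_normal:
  assumes "\<sigma> > 0"
  shows "(\<integral>\<^sup>+x. ennreal (normal_density 0 \<sigma> x) * ennreal (exp (q * x)) \<partial>lborel) = ennreal (exp (q\<^sup>2 * \<sigma>\<^sup>2 / 2))"
proof -
  have "normal_density 0 \<sigma> x * exp (q * x) = exp (q\<^sup>2 * \<sigma>\<^sup>2 / 2) * normal_density (q * \<sigma>\<^sup>2) \<sigma> x" for x
  proof -
    have "- (x - 0)\<^sup>2 / (2 * \<sigma>\<^sup>2) + q * x = q\<^sup>2 * \<sigma>\<^sup>2 / 2 + - (x - q * \<sigma>\<^sup>2)\<^sup>2 / (2 * \<sigma>\<^sup>2)"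
      using assms by (simp add: field_simps power2_eq_square)
    from arg_cong[OF this, of exp] show ?thesis
      unfolding exp_add normal_density_def by (simp add: ac_simps)
  qed
  then have "(\<integral>\<^sup>+x. ennreal (normal_density 0 \<sigma> x) * ennreal (exp (q * x)) \<partial>lborel)
     = (\<integral>\<^sup>+x. ennreal (exp (q\<^sup>2 * \<sigma>\<^sup>2 / 2)) * ennreal (normal_density (q * \<sigma>\<^sup>2) \<sigma> x) \<partial>lborel)"
    by (intro nn_integral_cong) (simp add: ennreal_mult[symmetric])
  also have "\<dots> = ennreal (exp (q\<^sup>2 * \<sigma>\<^sup>2 / 2)) * (\<integral>\<^sup>+x. ennreal (normal_density (q * \<sigma>\<^sup>2) \<sigma> x) \<partial>lborel)"
    by (intro nn_integral_cmult) measurable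
  also have "(\<integral>\<^sup>+x. ennreal (normal_density (q * \<sigma>\<^sup>2) \<sigma> x) \<partial>lborel) = 1"
    using assms by (subst nn_integral_eq_integral) auto
  finally show ?thesis by simp
qed

lemma Linf_set_integrable:
  assumes "a \<in> Linf T" shows "set_integrable lborel {0..T} a"
proof -
  obtain C where C: "AE t in lborel. t \<in> {0..T} \<longrightarrow> \<bar>a t\<bar> \<le> C" and m: "set_borel_measurable lborel {0..T} a"
    using assms by (auto simp: Linf_def)
  show ?thesis
    unfolding set_integrable_def
  proof (rule Bochner_Integration.integrable_bound)
    show "integrable lborel (\<lambda>t. indicator {0..T} t *\<^sub>R \<bar>C\<bar>)"
      by (intro integrable_scaleR_left integrable_real_indicator) (auto simp: emeasure_lborel_Icc_eq)
    show "AE t in lborel. norm (indicat_real {0..T} t *\<^sub>R a t) \<le> norm (indicat_real {0..T} t *\<^sub>R \<bar>C\<bar>)"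
      using C by eventually_elim (auto simp: indicator_def)
  qed (use m in \<open>simp add: set_borel_measurable_def\<close>)
qed

lemma continuous_on_primitive:
  assumes "a \<in> Linf T" shows "continuous_on {0..T} (primitive a)"
  unfolding primitive_def[abs_def] by (rule continuous_on_set_integral_Icc[OF Linf_set_integrable[OF assms]])

lemma brownian_motion_measurable:
  assumes "filtered_prob_space M Filt" "brownian_motion M Filt W" "t \<ge> 0"
  shows "W t \<in> borel_measurable M"
proof -
  interpret filtered_prob_space M Filt by fact
  show ?thesis
    using measurable_from_subalg[OF subalgebra_Filt] assms(2,3) unfolding brownian_motion_def by blast
qed

lemma brownian_increment_exp_moment:
  assumes "prob_space M" and W: "brownian_motion M Filt W" and "0 \<le> s" "s \<le> t"
  shows "(\<integral>\<^sup>+\<omega>. ennreal (exp (q * (W t \<omega> - W s \<omega>))) \<partial>M) = ennreal (exp (q\<^sup>2 * (t - s) / 2))"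
proof (cases "s = t")
  case True
  interpret prob_space M by fact
  show ?thesis using True by (simp add: emeasure_space_1)
next
  case False
  then have "s < t" using assms by simp
  then have "distributed M lborel (\<lambda>\<omega>. W t \<omega> - W s \<omega>) (normal_density 0 (sqrt (t - s)))"
    using W \<open>0 \<le> s\<close> unfolding brownian_motion_def by blast
  from distributed_nn_integral[OF this, of "\<lambda>x. ennreal (exp (q * x))"]
  have "(\<integral>\<^sup>+\<omega>. ennreal (exp (q * (W t \<omega> - W s \<omega>))) \<partial>M)
     = (\<integral>\<^sup>+x. ennreal (normal_density 0 (sqrt (t - s)) x) * ennreal (exp (q * x)) \<partial>lborel)" by simp
  also have "\<dots> = ennreal (exp (q\<^sup>2 * (sqrt (t - s))\<^sup>2 / 2))"
    using \<open>s < t\<close> by (intro nn_integral_exp_normal) simp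
  finally show ?thesis using \<open>s < t\<close> by simp
qed

text \<open>The weight dominates the \<open>L\<^sup>p\<close> norms, hence up to the factor \<open>2\<close> the first absolute moments, and
  Fubini's theorem exchanges expectation and time integral.\<close>

lemma AE_path_integrable:
  fixes w :: "real \<Rightarrow> real"
  assumes "prob_space M" and z [measurable]: "(\<lambda>(t, \<omega>). z t \<omega>) \<in> borel_measurable (time_measure T \<Otimes>\<^sub>M M)"
    and "p \<ge> 1" and w: "integrable (time_measure T) w" "\<And>t. t \<in> {0..T} \<Longrightarrow> w t \<ge> 1"
    and zp: "\<And>t. t \<in> {0..T} \<Longrightarrow> (\<integral>\<^sup>+\<omega>. ennreal (\<bar>z t \<omega>\<bar> powr p) \<partial>M) \<le> ennreal (w t powr p)"
  shows "AE \<omega> in M. integrable (time_measure T) (\<lambda>s. z s \<omega>)"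
proof -
  interpret prob_space M by fact
  interpret time: finite_measure "time_measure T" by (rule finite_time_measure)
  interpret pair: pair_sigma_finite "time_measure T" M by unfold_locales
  have "(\<integral>\<^sup>+\<omega>. (\<integral>\<^sup>+t. ennreal \<bar>z t \<omega>\<bar> \<partial>time_measure T) \<partial>M) = (\<integral>\<^sup>+t. (\<integral>\<^sup>+\<omega>. ennreal \<bar>z t \<omega>\<bar> \<partial>M) \<partial>time_measure T)"
    by (rule pair.Fubini'[where f = "\<lambda>t \<omega>. ennreal \<bar>z t \<omega>\<bar>"]) measurable
  also have "\<dots> \<le> (\<integral>\<^sup>+t. ennreal (2 * w t) \<partial>time_measure T)"
  proof (rule nn_integral_mono)
    fix t assume "t \<in> space (time_measure T)"
    then have t: "t \<in> {0..T}" by (simp add: space_time_measure)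
    have ws: "w t \<ge> 1" by (rule w(2)[OF t])
    have [measurable]: "z t \<in> borel_measurable M"
      using measurable_Pair2[OF z, of t] t by (simp add: space_time_measure)
    have "(\<integral>\<^sup>+\<omega>. ennreal \<bar>z t \<omega>\<bar> \<partial>M)
      \<le> (\<integral>\<^sup>+\<omega>. ennreal (w t) * (1 + ennreal (1 / w t powr p) * ennreal (\<bar>z t \<omega>\<bar> powr p)) \<partial>M)"
    proof (rule nn_integral_mono)
      fix \<omega>
      have "\<bar>z t \<omega>\<bar> / w t \<le> 1 + (\<bar>z t \<omega>\<bar> / w t) powr p"
        using powr_le_one_add_powr[of "\<bar>z t \<omega>\<bar> / w t" 1 p] ws \<open>p \<ge> 1\<close> by simp
      then have "w t * (\<bar>z t \<omega>\<bar> / w t) \<le> w t * (1 + 1 / w t powr p * \<bar>z t \<omega>\<bar> powr p)"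
        using ws by (intro mult_left_mono) (auto simp: powr_divide)
      then have "\<bar>z t \<omega>\<bar> \<le> w t * (1 + 1 / w t powr p * \<bar>z t \<omega>\<bar> powr p)" using ws by simp
      then have "ennreal \<bar>z t \<omega>\<bar> \<le> ennreal (w t * (1 + 1 / w t powr p * \<bar>z t \<omega>\<bar> powr p))" by (rule ennreal_leI)
      also have "\<dots> = ennreal (w t) * (1 + ennreal (1 / w t powr p) * ennreal (\<bar>z t \<omega>\<bar> powr p))"
        using ws by (simp add: ennreal_mult ennreal_plus del: times_divide_eq_left)
      finally show "ennreal \<bar>z t \<omega>\<bar> \<le> \<dots>" .
    qed
    also have "\<dots> = ennreal (w t) * (1 + ennreal (1 / w t powr p) * (\<integral>\<^sup>+\<omega>. ennreal (\<bar>z t \<omega>\<bar> powr p) \<partial>M))"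
      by (simp add: nn_integral_cmult nn_integral_add emeasure_space_1)
    also have "\<dots> \<le> ennreal (w t) * (1 + ennreal (1 / w t powr p) * ennreal (w t powr p))"
      using zp[OF t] by (intro mult_left_mono add_left_mono) auto
    also have "ennreal (1 / w t powr p) * ennreal (w t powr p) = 1"
      using ws by (simp flip: ennreal_mult)
    also have "ennreal (w t) * (1 + 1) = ennreal (2 * w t)"
      using ws by (simp add: ennreal_mult mult.commute)
    finally show "(\<integral>\<^sup>+\<omega>. ennreal \<bar>z t \<omega>\<bar> \<partial>M) \<le> ennreal (2 * w t)" .
  qed
  also have "\<dots> < \<infinity>"
    using w by (subst nn_integral_eq_integral) (auto intro!: AE_I2 intro: order_trans[of 0 1] simp: space_time_measure)
  finally have "AE \<omega> in M. (\<integral>\<^sup>+t. ennreal \<bar>z t \<omega>\<bar> \<partial>time_measure T) \<noteq> \<infinity>"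
    by (intro nn_integral_PInf_AE) (auto simp: less_top)
  moreover have "AE \<omega> in M. \<omega> \<in> space M" by (rule AE_space)
  ultimately show ?thesis
  proof eventually_elim
    case (elim \<omega>)
    then have "(\<lambda>s. z s \<omega>) \<in> borel_measurable (time_measure T)"
      using measurable_Pair1[OF z, of \<omega>] by simp
    then show ?case using elim by (intro integrableI_bounded) (auto simp: less_top)
  qed
qed

section \<open>Minimisation for the controlled diffusion\<close>

theorem theorem5p8:
  fixes M :: "'a measure" and Filt :: "real \<Rightarrow> 'a measure"
    and W z :: "real \<Rightarrow> 'a \<Rightarrow> real" and a L \<Psi> :: "real \<Rightarrow> real"
    and F :: "real \<Rightarrow> real \<Rightarrow> real" and T p \<alpha> \<delta> :: real
  assumes "T > 0"
    and "filtered_prob_space M Filt"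
    and "brownian_motion M Filt W"
    and "a \<in> Linf T"
    and z_adapted: "\<And>t. t \<in> {0..T} \<Longrightarrow> z t \<in> borel_measurable (Filt t)"
    and z_measurable: "(\<lambda>(t, \<omega>). z t \<omega>) \<in> borel_measurable (restrict_space borel {0..T} \<Otimes>\<^sub>M M)"
    and "p \<ge> 2"
    and z_Lp: "\<And>t. t \<in> {0..T} \<Longrightarrow> integrable M (\<lambda>\<omega>. \<bar>z t \<omega>\<bar> powr p)"
    and z_L2Lp: "set_integrable lborel {0..T} (\<lambda>t. (\<integral>\<omega>. \<bar>z t \<omega>\<bar> powr p \<partial>M) powr (2 / p))"
    and F_measurable: "(\<lambda>(t, x). F t x) \<in> borel_measurable (restrict_space borel ({0..T} \<times> UNIV))"
    and F_nonneg: "\<And>t x. t \<in> {0..T} \<Longrightarrow> F t x \<ge> 0"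
    and F_diff: "\<And>t x. t \<in> {0..T} \<Longrightarrow> F t differentiable (at x)"
    and F_diff2: "\<And>t x. t \<in> {0..T} \<Longrightarrow> deriv (F t) differentiable (at x)"
    and F_cont1: "continuous_on ({0..T} \<times> UNIV) (\<lambda>(t, x). deriv (F t) x)"
    and F_cont2: "continuous_on ({0..T} \<times> UNIV) (\<lambda>(t, x). deriv (deriv (F t)) x)"
    and "0 < \<alpha>" and "\<alpha> < p"
    and "L \<in> L1 T"
    and L_nonneg: "\<And>t. t \<in> {0..T} \<Longrightarrow> L t \<ge> 0"
    and F_growth: "\<And>t x. t \<in> {0..T} \<Longrightarrow>
          \<bar>F t x\<bar> + \<bar>deriv (F t) x\<bar> + \<bar>deriv (deriv (F t)) x\<bar> \<le> L t * (1 + \<bar>x\<bar> powr \<alpha>)"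
    and F_convex: "\<And>t. t \<in> {0..T} \<Longrightarrow> convex_on UNIV (F t)"
    and "\<delta> > 0"
    and "young_function \<Psi>" and "Delta2 \<Psi>"
  shows "\<exists>u. is_arg_min (penalized_cost M T W a z F \<delta> \<Psi>) (\<lambda>v. v \<in> L1 T) u \<and>
           ((\<forall>t\<in>{0..T}. strictly_convex_on UNIV (F t)) \<or> strictly_convex_on {0..} \<Psi> \<longrightarrow>
              (\<forall>v. is_arg_min (penalized_cost M T W a z F \<delta> \<Psi>) (\<lambda>v. v \<in> L1 T) v \<longrightarrow>
                 (AE t in lborel. t \<in> {0..T} \<longrightarrow> v t = u t)))"
proof -
  interpret filtered_prob_space M Filt by fact
  interpret time: finite_measure "time_measure T" by (rule finite_time_measure)
  have T: "T \<ge> 0" using \<open>T > 0\<close> by simp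
  have z_pair: "(\<lambda>(t, \<omega>). z t \<omega>) \<in> borel_measurable (time_measure T \<Otimes>\<^sub>M M)"
  proof -
    have "sets (restrict_space borel {0..T} \<Otimes>\<^sub>M M) = sets (time_measure T \<Otimes>\<^sub>M M)"
      by (intro sets_pair_measure_cong sets_restrict_space_cong) auto
    then show ?thesis using z_measurable by (simp cong: measurable_cong_sets)
  qed
  define E where "E t = (\<integral>\<omega>. \<bar>z t \<omega>\<bar> powr p \<partial>M)" for t
  \<comment> \<open>With \<open>n\<close> for the \<open>L\<^sup>p\<close> norm of \<open>z t\<close> this is \<open>1 + n\<^sup>2\<close>, integrable in time by assumption and at least \<open>n\<close>.\<close>
  define w where "w t = 1 + E t powr (2 / p)" for t
  have w_int: "integrable (time_measure T) w"
  proof -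
    have "integrable (time_measure T) (\<lambda>t. E t powr (2 / p))"
      using z_L2Lp by (simp only: integrable_time_measure_iff E_def)
    then show ?thesis unfolding w_def by simp
  qed
  have w_ge: "w t \<ge> 1" for t by (simp add: w_def)
  have z_moment: "(\<integral>\<^sup>+\<omega>. ennreal (\<bar>z t \<omega>\<bar> powr p) \<partial>M) \<le> ennreal (w t powr p)" if t: "t \<in> {0..T}" for t
  proof -
    have E0: "E t \<ge> 0" by (simp add: E_def)
    have "E t = (E t powr (1 / p)) powr p" using E0 \<open>p \<ge> 2\<close> by (simp add: powr_powr)
    also have "\<dots> \<le> w t powr p"
      using powr_le_one_add_powr[OF E0, of "1 / p" "2 / p"] \<open>p \<ge> 2\<close>
      by (intro powr_mono2) (auto simp: w_def divide_right_mono)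
    finally have "ennreal (E t) \<le> ennreal (w t powr p)" by (rule ennreal_leI)
    then show ?thesis unfolding E_def by (subst nn_integral_eq_integral[OF z_Lp[OF t]]) auto
  qed

  have "AE \<omega> in M. continuous_on {0..} (\<lambda>t. W t \<omega>) \<and> integrable (time_measure T) (\<lambda>s. z s \<omega>)"
    using \<open>brownian_motion M Filt W\<close> AE_path_integrable[OF prob_space_axioms z_pair _ w_int w_ge z_moment] \<open>p \<ge> 2\<close>
    by (auto simp: brownian_motion_def)
  then obtain N where N: "N \<in> null_sets M"
    "\<And>\<omega>. \<omega> \<in> space M - N \<Longrightarrow> continuous_on {0..} (\<lambda>t. W t \<omega>) \<and> integrable (time_measure T) (\<lambda>s. z s \<omega>)"
    by (auto elim!: AE_E3)
  have AE_N: "AE \<omega> in M. \<omega> \<in> space M - N"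
    using AE_not_in[OF N(1)] AE_space by eventually_elim auto
  have N_sets [measurable]: "N \<in> sets M" using N(1) by auto
  \<comment> \<open>The constants \<open>0\<close> and \<open>1\<close> on the null set \<open>N\<close> keep the modified processes measurable and regular there.\<close>
  define Z where "Z t \<omega> = (if \<omega> \<in> N then 0 else z t \<omega>)" for t \<omega>
  define H where "H t \<omega> = (if \<omega> \<in> N then 1 else geom_bm W t \<omega> * exp (primitive a t))" for t \<omega>
  have cont_a: "continuous_on {0..T} (primitive a)" by (rule continuous_on_primitive) fact
  have W_meas: "W t \<in> borel_measurable M" if "t \<ge> 0" for t
    using brownian_motion_measurable[OF \<open>filtered_prob_space M Filt\<close> \<open>brownian_motion M Filt W\<close> that] .
  have H_cont: "continuous_on {0..T} (\<lambda>t. H t \<omega>)" if "\<omega> \<in> space M" for \<omega>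
  proof (cases "\<omega> \<in> N")
    case False
    then have "continuous_on {0..T} (\<lambda>t. W t \<omega>)" using N(2)[of \<omega>] that by (auto intro: continuous_on_subset)
    then show ?thesis using False unfolding H_def geom_bm_def by (simp add: continuous_intros cont_a)
  qed (simp add: H_def)
  interpret convex_state_cost M T H Z F
  proof unfold_locales
    show "(\<lambda>(t, \<omega>). H t \<omega>) \<in> borel_measurable (time_measure T \<Otimes>\<^sub>M M)"
    proof (rule measurable_of_continuous_paths[OF _ T H_cont])
      fix t assume "t \<in> {0..T}"
      then have [measurable]: "W t \<in> borel_measurable M" by (intro W_meas) simp
      show "H t \<in> borel_measurable M" unfolding H_def geom_bm_def by measurable
    qed
    have "(\<lambda>q. if snd q \<in> N then 0 else z (fst q) (snd q)) \<in> borel_measurable (time_measure T \<Otimes>\<^sub>M M)"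
      using z_pair by (intro measurable_If) (simp_all add: split_def)
    then show "(\<lambda>(t, \<omega>). Z t \<omega>) \<in> borel_measurable (time_measure T \<Otimes>\<^sub>M M)"
      by (simp add: Z_def split_def)
    show "integrable (time_measure T) (\<lambda>s. Z s \<omega>)" if "\<omega> \<in> space M" for \<omega>
      using N(2)[of \<omega>] that by (cases "\<omega> \<in> N") (auto simp: Z_def)
    show "continuous_on UNIV (F t)" if "t \<in> {0..T}" for t
      using F_diff[OF that] by (intro continuous_at_imp_continuous_on) (auto intro: differentiable_imp_continuous_within)
  qed (use T H_cont F_measurable F_nonneg F_convex in \<open>auto simp: H_def geom_bm_def\<close>)

  have state_eq: "state W a z u t \<omega> = \<xi> u t \<omega>" if "\<omega> \<in> space M - N" "t \<in> {0..T}" for u t \<omega>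
  proof -
    have "(LINT s:{0..t}|lborel. exp (- primitive a s) / geom_bm W s \<omega> * (z s \<omega> - u s))
      = (\<integral>s. indicator {0..t} s / H s \<omega> * (Z s \<omega> - u s) \<partial>time_measure T)"
      unfolding set_lebesgue_integral_def
    proof (subst integral_restrict_space, simp, intro Bochner_Integration.integral_cong refl)
      fix s
      have "exp (- primitive a s) / geom_bm W s \<omega> = 1 / H s \<omega>"
        using that by (simp add: H_def exp_minus field_simps)
      then show "indicator {0..t} s *\<^sub>R (exp (- primitive a s) / geom_bm W s \<omega> * (z s \<omega> - u s))
        = indicator {0..T} s *\<^sub>R (indicator {0..t} s / H s \<omega> * (Z s \<omega> - u s))"
        using that by (auto simp: Z_def indicator_def)
    qed
    moreover have "geom_bm W t \<omega> * exp (primitive a t) = H t \<omega>"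
      using that by (simp add: H_def)
    ultimately show ?thesis by (simp add: state_def \<xi>_def)
  qed
  have cost_eq: "cost M T W a z F u = state_cost u" if u: "integrable (time_measure T) u" for u
  proof -
    have "cost M T W a z F u = (\<integral>\<^sup>+\<omega>. (\<integral>\<^sup>+t. ennreal (F t (\<xi> u t \<omega>)) \<partial>time_measure T) \<partial>M)"
      unfolding cost_def
    proof (rule nn_integral_cong_AE)
      show "AE \<omega> in M. (\<integral>\<^sup>+t\<in>{0..T}. ennreal (F t (state W a z u t \<omega>)) \<partial>lborel)
        = (\<integral>\<^sup>+t. ennreal (F t (\<xi> u t \<omega>)) \<partial>time_measure T)"
        using AE_N
      proof eventually_elim
        case (elim \<omega>)
        then show ?case
          by (subst nn_integral_restrict_space)
            (auto intro!: nn_integral_cong simp: state_eq[OF elim] indicator_def)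
      qed
    qed
    also have "\<dots> = state_cost u"
      unfolding state_cost_def using running_cost_measurable[OF u]
      by (subst pair.nn_integral_snd[symmetric]) auto
    finally show ?thesis .
  qed
  have penalized_eq: "penalized_cost M T W a z F \<delta> \<Psi> u = penalized \<delta> \<Psi> u" if "u \<in> L1 T" for u
  proof -
    have u: "integrable (time_measure T) u" using that by (simp add: L1_def integrable_time_measure_iff)
    have "young_integral T \<Psi> u = (\<integral>\<^sup>+t. ennreal (\<Psi> \<bar>u t\<bar>) \<partial>time_measure T)"
      unfolding young_integral_def by (subst nn_integral_restrict_space) auto
    then show ?thesis using cost_eq[OF u] by (simp add: penalized_cost_def penalized_def)
  qed

  \<comment> \<open>The primitive of \<open>a\<close> and the drift \<open>- t / 2\<close> are bounded on the time interval, so they only contribute the constant factor.\<close>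
  have ratio: "\<exists>C. \<forall>s t. 0 \<le> s \<longrightarrow> s \<le> t \<longrightarrow> t \<le> T \<longrightarrow>
        (\<integral>\<^sup>+\<omega>. ennreal ((H t \<omega> / H s \<omega>) powr q) \<partial>M) \<le> ennreal C" for q
  proof -
    obtain B where "\<forall>t\<in>{0..T}. \<bar>primitive a t\<bar> \<le> B"
      using compact_imp_bounded[OF compact_continuous_image[OF cont_a compact_Icc]]
      by (auto simp: bounded_iff)
    then have B: "\<bar>primitive a t\<bar> \<le> B" if "t \<in> {0..T}" for t using that by blast
    have "(\<integral>\<^sup>+\<omega>. ennreal ((H t \<omega> / H s \<omega>) powr q) \<partial>M) \<le> ennreal (exp (\<bar>q\<bar> * (2 * B + T)) * exp (q\<^sup>2 * T / 2))"
      if st: "0 \<le> s" "s \<le> t" "t \<le> T" for s t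
    proof -
      have "(\<integral>\<^sup>+\<omega>. ennreal ((H t \<omega> / H s \<omega>) powr q) \<partial>M)
        \<le> (\<integral>\<^sup>+\<omega>. ennreal (exp (\<bar>q\<bar> * (2 * B + T))) * ennreal (exp (q * (W t \<omega> - W s \<omega>))) \<partial>M)"
      proof (rule nn_integral_mono_AE)
        show "AE \<omega> in M. ennreal ((H t \<omega> / H s \<omega>) powr q)
          \<le> ennreal (exp (\<bar>q\<bar> * (2 * B + T))) * ennreal (exp (q * (W t \<omega> - W s \<omega>)))"
          using AE_N
        proof eventually_elim
          case (elim \<omega>)
          let ?d = "primitive a t - primitive a s - (t - s) / 2"
          have "H t \<omega> / H s \<omega> = exp (?d + (W t \<omega> - W s \<omega>))"
            using elim by (simp add: H_def geom_bm_def flip: exp_add exp_diff) (simp add: diff_divide_distrib)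
          then have "(H t \<omega> / H s \<omega>) powr q = exp (q * ?d + q * (W t \<omega> - W s \<omega>))"
            by (simp add: powr_def algebra_simps)
          also have "\<dots> \<le> exp (\<bar>q\<bar> * (2 * B + T)) * exp (q * (W t \<omega> - W s \<omega>))"
          proof -
            have "0 \<le> (t - s) / 2" "(t - s) / 2 \<le> T" using st by (simp_all add: field_simps)
            moreover have "\<bar>primitive a t\<bar> \<le> B" "\<bar>primitive a s\<bar> \<le> B" using B st by auto
            ultimately have d: "\<bar>?d\<bar> \<le> 2 * B + T" by linarith
            have "q * ?d \<le> \<bar>q\<bar> * \<bar>?d\<bar>" using abs_ge_self[of "q * ?d"] by (simp only: abs_mult)
            also have "\<dots> \<le> \<bar>q\<bar> * (2 * B + T)" using d by (rule mult_left_mono) simp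
            finally have "exp (q * ?d + q * (W t \<omega> - W s \<omega>)) \<le> exp (\<bar>q\<bar> * (2 * B + T) + q * (W t \<omega> - W s \<omega>))"
              by (simp del: mult_le_cancel_left)
            then show ?thesis by (simp only: exp_add)
          qed
          finally show ?case by (simp add: ennreal_leI flip: ennreal_mult)
        qed
      qed
      also have "\<dots> = ennreal (exp (\<bar>q\<bar> * (2 * B + T))) * (\<integral>\<^sup>+\<omega>. ennreal (exp (q * (W t \<omega> - W s \<omega>))) \<partial>M)"
      proof (rule nn_integral_cmult)
        have [measurable]: "W t \<in> borel_measurable M" "W s \<in> borel_measurable M" using st by (auto intro!: W_meas)
        show "(\<lambda>\<omega>. ennreal (exp (q * (W t \<omega> - W s \<omega>)))) \<in> borel_measurable M" by measurable
      qed
      also have "\<dots> = ennreal (exp (\<bar>q\<bar> * (2 * B + T)) * exp (q\<^sup>2 * (t - s) / 2))"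
        using brownian_increment_exp_moment[OF prob_space_axioms \<open>brownian_motion M Filt W\<close> st(1,2)]
        by (simp flip: ennreal_mult)
      also have "\<dots> \<le> ennreal (exp (\<bar>q\<bar> * (2 * B + T)) * exp (q\<^sup>2 * T / 2))"
        using st by (intro ennreal_leI mult_left_mono) (auto intro!: mult_left_mono)
      finally show ?thesis .
    qed
    then show ?thesis by blast
  qed
  have Z_moment: "(\<integral>\<^sup>+\<omega>. ennreal (\<bar>Z t \<omega>\<bar> powr p) \<partial>M) \<le> ennreal (w t powr p)" if "t \<in> {0..T}" for t
  proof -
    have "(\<integral>\<^sup>+\<omega>. ennreal (\<bar>Z t \<omega>\<bar> powr p) \<partial>M) \<le> (\<integral>\<^sup>+\<omega>. ennreal (\<bar>z t \<omega>\<bar> powr p) \<partial>M)"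
      by (intro nn_integral_mono) (simp add: Z_def)
    also have "\<dots> \<le> ennreal (w t powr p)" by (rule z_moment[OF that])
    finally show ?thesis .
  qed
  have growth: "F t x \<le> L t * (1 + \<bar>x\<bar> powr \<alpha>)" if "t \<in> {0..T}" for t x
    using F_growth[OF that, of x] by linarith
  have "state_cost (\<lambda>_. 0) < \<infinity>"
    using \<open>L \<in> L1 T\<close> \<open>p \<ge> 2\<close> \<open>0 < \<alpha>\<close> \<open>\<alpha> < p\<close>
    by (intro state_cost_zero_finite[OF \<open>T > 0\<close> _ _ _ _ L_nonneg growth w_int w_ge Z_moment ratio])
      (auto simp: L1_def integrable_time_measure_iff)
  then have fin0: "penalized \<delta> \<Psi> (\<lambda>_. 0) < \<infinity>"
    by (simp add: penalized_def young_function_zero[OF \<open>young_function \<Psi>\<close>])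

  have L1_iff: "v \<in> L1 T \<longleftrightarrow> integrable (time_measure T) v" for v
    by (simp add: L1_def integrable_time_measure_iff)
  obtain u where u: "u \<in> L1 T" "penalized \<delta> \<Psi> u < \<infinity>" "\<And>v. v \<in> L1 T \<Longrightarrow> penalized \<delta> \<Psi> u \<le> penalized \<delta> \<Psi> v"
    using exists_penalized_minimizer[OF \<open>young_function \<Psi>\<close> \<open>\<delta> > 0\<close> _ fin0] by (auto simp: L1_iff)
  have argmin: "is_arg_min (penalized_cost M T W a z F \<delta> \<Psi>) (\<lambda>v. v \<in> L1 T) v
      \<longleftrightarrow> v \<in> L1 T \<and> penalized \<delta> \<Psi> v = penalized \<delta> \<Psi> u" for v
  proof
    assume *: "is_arg_min (penalized_cost M T W a z F \<delta> \<Psi>) (\<lambda>v. v \<in> L1 T) v"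
    then have v: "v \<in> L1 T" by (simp add: is_arg_min_def)
    have "\<not> penalized \<delta> \<Psi> u < penalized \<delta> \<Psi> v"
      using * u(1) v by (auto simp: is_arg_min_def penalized_eq)
    then show "v \<in> L1 T \<and> penalized \<delta> \<Psi> v = penalized \<delta> \<Psi> u" using u(3)[OF v] v by auto
  next
    assume "v \<in> L1 T \<and> penalized \<delta> \<Psi> v = penalized \<delta> \<Psi> u"
    then show "is_arg_min (penalized_cost M T W a z F \<delta> \<Psi>) (\<lambda>v. v \<in> L1 T) v"
      using u(3) by (auto simp: is_arg_min_def penalized_eq not_less)
  qed
  show ?thesis
  proof (intro exI conjI impI allI)
    show "is_arg_min (penalized_cost M T W a z F \<delta> \<Psi>) (\<lambda>v. v \<in> L1 T) u" using u(1) by (simp add: argmin)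
    fix v
    assume strict: "(\<forall>t\<in>{0..T}. strictly_convex_on UNIV (F t)) \<or> strictly_convex_on {0..} \<Psi>"
      and "is_arg_min (penalized_cost M T W a z F \<delta> \<Psi>) (\<lambda>v. v \<in> L1 T) v"
    then have v: "v \<in> L1 T" "penalized \<delta> \<Psi> v = penalized \<delta> \<Psi> u" by (simp_all add: argmin)
    have "AE t in time_measure T. v t = u t"
      using u v by (intro penalized_minimizer_unique[OF \<open>young_function \<Psi>\<close> \<open>\<delta> > 0\<close> \<open>T > 0\<close> strict]) (auto simp: L1_iff)
    then show "AE t in lborel. t \<in> {0..T} \<longrightarrow> v t = u t"
      by (subst (asm) AE_restrict_space_iff) auto
  qed
qed

end
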